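(* Let $r\ge2$ be an integer and $Q$ be an $r$-graph. Let $\mathcal{F},\hat{\mathcal{F}}$ be two families of $r$-graphs such that $\hat{\mathcal{F}}\le_{\mathrm{hom}}\mathcal{F}$ and $\pi_{\mathrm{inj}}(Q,\mathcal{F})>0$. Let $\mathfrak{H}$ be a hereditary family of $(\hat{\mathcal{F}}\cup\mathcal{F})$-free $r$-graphs. Suppose that (i) $Q$ is symmetrization-increasing, (ii) $\hat{\mathcal{F}}$ is blowup-invariant, (iii) $\hat{\mathcal{F}}$ is symmetrized-stable with respect to $\mathfrak{H}$, and (iv) both $\hat{\mathcal{F}}$ and $\mathcal{F}$ are $Q$-vertex-extendable with respect to $\mathfrak{H}$. Then $\mathcal{F}$ is $Q$-degree-stable with respect to $\mathfrak{H}$.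
   Context: An $r$-graph is a set of $r$-subsets of a finite vertex set. A homomorphism $Q\to\mathcal{H}$ is a map $\phi\colon V(Q)\to V(\mathcal{H})$ with $\phi(e)\in\mathcal{H}$ for all $e\in Q$; $Q$ is then $\mathcal{H}$-colorable. $\mathrm{inj}(Q,\mathcal{H})$ counts injective homomorphisms; $d_{Q,\mathcal{H}}(v)$ counts injective homomorphisms $\phi$ with $v\in\phi(V(Q))$; $\delta_Q(\mathcal{H})$ is its minimum over $v$. $\mathcal{H}$ is $\mathcal{F}$-free if it contains no member of $\mathcal{F}$ as a subgraph; $\mathrm{inj}(n,Q,\mathcal{F})=\max\{\mathrm{inj}(Q,\mathcal{H}):v(\mathcal{H})=n,\ \mathcal{H}\ \mathcal{F}\text{-free}\}$ and $\pi_{\mathrm{inj}}(Q,\mathcal{F})=\lim_{n\to\infty}\mathrm{inj}(n,Q,\mathcal{F})/n^{v(Q)}$. A family of $r$-graphs is hereditary if closed under (not necessarily induced) subgraphs. $\hat{\mathcal{F}}\le_{\mathrm{hom}}\mathcal{F}$ means: for every $\hat F\in\hat{\mathcal{F}}$ there is $F\in\mathcal{F}$ that is $\hat F$-colorable. Blowup: for an $r$-graph $\mathcal{G}$ on $[m]$ and pairwise disjoint sets $V_1,\dots,V_m$, $\mathcal{G}(V_1,\dots,V_m)$ replaces vertex $i$ by $V_i$ and each edge $\{i_1,\dots,i_r\}$ by the complete $r$-partite $r$-graph on $V_{i_1},\dots,V_{i_r}$. A family $\mathcal{F}$ is blowup-invariant if every blowup of every $\mathcal{F}$-free $r$-graph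 is $\mathcal{F}$-free. $L_{\mathcal{H}}(v)=\{e:e\cup\{v\}\in\mathcal{H}\}$; a pair $u,v$ is uncovered if no edge contains both, equivalent if $L_{\mathcal{H}}(u)=L_{\mathcal{H}}(v)$; $\mathcal{H}$ is symmetrized if every uncovered pair is equivalent; $\mathcal{H}_{u\to v}=(\mathcal{H}\setminus\{E:u\in E\})\cup\{\{u\}\cup e:e\in L_{\mathcal{H}}(v)\}$. $Q$ is symmetrization-increasing if for every $r$-graph $\mathcal{H}$ and uncovered pair $u,v$, either $\mathrm{inj}(Q,\mathcal{H})<\max\{\mathrm{inj}(Q,\mathcal{H}_{u\to v}),\mathrm{inj}(Q,\mathcal{H}_{v\to u})\}$ or all three values are equal. With respect to $\mathfrak{H}$: $\mathcal{F}$ is symmetrized-stable if every symmetrized $\mathcal{F}$-free $r$-graph is in $\mathfrak{H}$; $Q$-degree-stable if there exist $\varepsilon>0,N_0$ such that every $\mathcal{F}$-free $r$-graph $\mathcal{H}$ on $n\ge N_0$ vertices with $\delta_Q(\mathcal{H})\ge(1-\varepsilon)\frac{v(Q)\,\mathrm{inj}(n,Q,\mathcal{F})}{n}$ is in $\mathfrak{H}$; $Q$-vertex-extendable if there exist $\varepsilon>0,N_0$ such that every $\mathcal{F}$-free $r$-graph $\mathcal{H}$ on $n\ge N_0$ vertices with $\delta_Q(\mathcal{H})\ge(1-\varepsilon)\frac{v(Q)\,\mathrm{inj}(n,Q,\mathcal{F})}{n}$ and $\mathcal{H}-v\in\mathfrak{H}$ for some vertex $v$ is in $\mathfrak{H}$.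 *)

theory Defs
  imports Complex_Main "HOL-Library.FuncSet" "HOL-Library.Disjoint_Sets"
begin

text \<open>
  Hypergraphs live on finite sets of natural numbers. This loses no generality: every finite
  hypergraph is isomorphic to one of this kind, and containment in a family is always tested up to
  isomorphism. The vertex set is part of the data, so isolated vertices count.
\<close>

record hypergraph =
  verts :: "nat set"
  edges :: "nat set set"

definition rgraph :: "nat \<Rightarrow> hypergraph \<Rightarrow> bool" where
  "rgraph r H \<longleftrightarrow> finite (verts H) \<and> (\<forall>e\<in>edges H. e \<subseteq> verts H \<and> card e = r)"

definition hom :: "hypergraph \<Rightarrow> hypergraph \<Rightarrow> (nat \<Rightarrow> nat) \<Rightarrow> bool" where
  "hom Q H \<phi> \<longleftrightarrow> \<phi> \<in> verts Q \<rightarrow> verts H \<and> (\<forall>e\<in>edges Q. \<phi> ` e \<in> edges H)"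

definition colorable :: "hypergraph \<Rightarrow> hypergraph \<Rightarrow> bool" where
  "colorable H Q \<longleftrightarrow> (\<exists>\<phi>. hom Q H \<phi>)"

text \<open>Maps are taken extensional on \<open>verts Q\<close>, so that counting functions counts maps on \<open>verts Q\<close>.\<close>

definition inj_homs :: "hypergraph \<Rightarrow> hypergraph \<Rightarrow> (nat \<Rightarrow> nat) set" where
  "inj_homs Q H = {\<phi> \<in> extensional (verts Q). hom Q H \<phi> \<and> inj_on \<phi> (verts Q)}"

definition inj_count :: "hypergraph \<Rightarrow> hypergraph \<Rightarrow> nat" where
  "inj_count Q H = card (inj_homs Q H)"

definition degree :: "hypergraph \<Rightarrow> hypergraph \<Rightarrow> nat \<Rightarrow> nat" where
  "degree Q H v = card {\<phi> \<in> inj_homs Q H. v \<in> \<phi> ` verts Q}"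

definition min_degree :: "hypergraph \<Rightarrow> hypergraph \<Rightarrow> nat" where
  "min_degree Q H = Min (degree Q H ` verts H)"

definition subgraph :: "hypergraph \<Rightarrow> hypergraph \<Rightarrow> bool" where
  "subgraph G H \<longleftrightarrow> verts G \<subseteq> verts H \<and> edges G \<subseteq> edges H"

text \<open>\<open>H\<close> contains a member of the family as a subgraph (up to isomorphism) iff some member has an
  injective homomorphism into \<open>H\<close>.\<close>

definition free :: "hypergraph set \<Rightarrow> hypergraph \<Rightarrow> bool" where
  "free \<F> H \<longleftrightarrow> (\<forall>F\<in>\<F>. \<not> (\<exists>\<phi>. hom F H \<phi> \<and> inj_on \<phi> (verts F)))"

definition free_inj_counts :: "nat \<Rightarrow> nat \<Rightarrow> hypergraph \<Rightarrow> hypergraph set \<Rightarrow> nat set" where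
  "free_inj_counts r n Q \<F> =
     {inj_count Q H | H. rgraph r H \<and> card (verts H) = n \<and> free \<F> H}"

text \<open>The inserted \<open>0\<close> only matters if there is no free \<open>r\<close>-graph on \<open>n\<close> vertices.\<close>

definition inj_max :: "nat \<Rightarrow> nat \<Rightarrow> hypergraph \<Rightarrow> hypergraph set \<Rightarrow> nat" where
  "inj_max r n Q \<F> = Max (insert 0 (free_inj_counts r n Q \<F>))"

definition pi_inj :: "nat \<Rightarrow> hypergraph \<Rightarrow> hypergraph set \<Rightarrow> real" where
  "pi_inj r Q \<F> = lim (\<lambda>n. real (inj_max r n Q \<F>) / real n ^ card (verts Q))"

text \<open>Closure under isomorphism is not required here; isomorphism-closed families
  are a special case.\<close>

definition hereditary :: "nat \<Rightarrow> hypergraph set \<Rightarrow> bool" where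
  "hereditary r \<HH> \<longleftrightarrow> (\<forall>H\<in>\<HH>. \<forall>G. rgraph r G \<and> subgraph G H \<longrightarrow> G \<in> \<HH>)"

definition le_hom :: "hypergraph set \<Rightarrow> hypergraph set \<Rightarrow> bool" where
  "le_hom \<F>' \<F> \<longleftrightarrow> (\<forall>F'\<in>\<F>'. \<exists>F\<in>\<F>. colorable F' F)"

definition blowup :: "hypergraph \<Rightarrow> (nat \<Rightarrow> nat set) \<Rightarrow> hypergraph" where
  "blowup G V =
     \<lparr>verts = (\<Union>i\<in>verts G. V i),
      edges = {E. \<exists>e\<in>edges G. E \<subseteq> (\<Union>i\<in>e. V i) \<and> (\<forall>i\<in>e. card (E \<inter> V i) = 1)}\<rparr>"

definition blowup_invariant :: "nat \<Rightarrow> hypergraph set \<Rightarrow> bool" where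
  "blowup_invariant r \<F> \<longleftrightarrow>
     (\<forall>G V. rgraph r G \<and> free \<F> G \<and> (\<forall>i\<in>verts G. finite (V i)) \<and> disjoint_family_on V (verts G)
        \<longrightarrow> free \<F> (blowup G V))"

text \<open>The condition \<open>v \<notin> e\<close> makes the link consist of \<open>(r - 1)\<close>-sets; without it
  every edge containing \<open>v\<close> would also be in the link of \<open>v\<close>.\<close>

definition link :: "hypergraph \<Rightarrow> nat \<Rightarrow> nat set set" where
  "link H v = {e. v \<notin> e \<and> e \<union> {v} \<in> edges H}"

definition uncovered :: "hypergraph \<Rightarrow> nat \<Rightarrow> nat \<Rightarrow> bool" where
  "uncovered H u v \<longleftrightarrow>
     u \<in> verts H \<and> v \<in> verts H \<and> u \<noteq> v \<and> \<not> (\<exists>e\<in>edges H. u \<in> e \<and> v \<in> e)"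

definition equivalent :: "hypergraph \<Rightarrow> nat \<Rightarrow> nat \<Rightarrow> bool" where
  "equivalent H u v \<longleftrightarrow> link H u = link H v"

definition symmetrized :: "hypergraph \<Rightarrow> bool" where
  "symmetrized H \<longleftrightarrow> (\<forall>u v. uncovered H u v \<longrightarrow> equivalent H u v)"

text \<open>\<open>symmetrize H u v\<close> is the hypergraph $\mathcal{H}_{u \to v}$.\<close>

definition symmetrize :: "hypergraph \<Rightarrow> nat \<Rightarrow> nat \<Rightarrow> hypergraph" where
  "symmetrize H u v =
     \<lparr>verts = verts H,
      edges = (edges H - {E. u \<in> E}) \<union> {{u} \<union> e | e. e \<in> link H v}\<rparr>"

definition symmetrization_increasing :: "nat \<Rightarrow> hypergraph \<Rightarrow> bool" where
  "symmetrization_increasing r Q \<longleftrightarrow>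
     (\<forall>H u v. rgraph r H \<and> uncovered H u v \<longrightarrow>
        inj_count Q H < max (inj_count Q (symmetrize H u v)) (inj_count Q (symmetrize H v u)) \<or>
        (inj_count Q H = inj_count Q (symmetrize H u v) \<and>
         inj_count Q H = inj_count Q (symmetrize H v u)))"

definition remove_vertex :: "hypergraph \<Rightarrow> nat \<Rightarrow> hypergraph" where
  "remove_vertex H v = \<lparr>verts = verts H - {v}, edges = {e \<in> edges H. v \<notin> e}\<rparr>"

definition symmetrized_stable :: "nat \<Rightarrow> hypergraph set \<Rightarrow> hypergraph set \<Rightarrow> bool" where
  "symmetrized_stable r \<F> \<HH> \<longleftrightarrow>
     (\<forall>H. rgraph r H \<and> free \<F> H \<and> symmetrized H \<longrightarrow> H \<in> \<HH>)"

definition large_min_degree ::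
  "nat \<Rightarrow> hypergraph \<Rightarrow> hypergraph set \<Rightarrow> real \<Rightarrow> hypergraph \<Rightarrow> bool" where
  "large_min_degree r Q \<F> \<epsilon> H \<longleftrightarrow>
     (let n = card (verts H) in
      real (min_degree Q H) \<ge>
        (1 - \<epsilon>) * (real (card (verts Q)) * real (inj_max r n Q \<F>) / real n))"

definition degree_stable :: "nat \<Rightarrow> hypergraph \<Rightarrow> hypergraph set \<Rightarrow> hypergraph set \<Rightarrow> bool" where
  "degree_stable r Q \<F> \<HH> \<longleftrightarrow>
     (\<exists>\<epsilon>>0. \<exists>N\<^sub>0. \<forall>H. rgraph r H \<and> free \<F> H \<and> card (verts H) \<ge> N\<^sub>0 \<and>
        large_min_degree r Q \<F> \<epsilon> H \<longrightarrow> H \<in> \<HH>)"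

definition vertex_extendable ::
  "nat \<Rightarrow> hypergraph \<Rightarrow> hypergraph set \<Rightarrow> hypergraph set \<Rightarrow> bool" where
  "vertex_extendable r Q \<F> \<HH> \<longleftrightarrow>
     (\<exists>\<epsilon>>0. \<exists>N\<^sub>0. \<forall>H. rgraph r H \<and> free \<F> H \<and> card (verts H) \<ge> N\<^sub>0 \<and>
        large_min_degree r Q \<F> \<epsilon> H \<and> (\<exists>v\<in>verts H. remove_vertex H v \<in> \<HH>) \<longrightarrow> H \<in> \<HH>)"

text \<open>The maximum in \<open>inj_max\<close> is over a finite set.\<close>

lemma finite_free_inj_counts:
  assumes "rgraph r Q"
  shows "finite (free_inj_counts r n Q \<F>)"
proof -
  have fQ: "finite (verts Q)"
    using assms by (simp add: rgraph_def)
  have "inj_count Q H \<le> n ^ card (verts Q)" if "rgraph r H" "card (verts H) = n" for H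
  proof -
    have "inj_homs Q H \<subseteq> (verts Q \<rightarrow>\<^sub>E verts H)"
      by (auto simp: inj_homs_def hom_def PiE_def)
    moreover have "finite (verts Q \<rightarrow>\<^sub>E verts H)"
      using fQ that by (intro finite_PiE) (auto simp: rgraph_def)
    ultimately have "card (inj_homs Q H) \<le> card (verts Q \<rightarrow>\<^sub>E verts H)"
      by (rule card_mono[rotated])
    then show ?thesis
      using fQ that by (simp add: inj_count_def card_PiE)
  qed
  then have "free_inj_counts r n Q \<F> \<subseteq> {..n ^ card (verts Q)}"
    by (auto simp: free_inj_counts_def)
  then show ?thesis
    by (rule finite_subset) simp
qed

end

theory Submission
  imports Defs
begin

text \<open>
  Symmetrizing one vertex at a time increases the lexicographic potential (number of maps, number
  of equivalent pairs) and changes the graph at a single vertex only. So, by induction on the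
  potential, every nearly extremal \<open>\<F>'\<close>-free graph lands in \<open>\<HH>\<close> once its few vertices of low
  degree are deleted: its symmetrization does, and the vertices in which the two differ are put
  back by vertex-extendability. The symmetrized case also shows that the extremal numbers of \<open>\<F>'\<close>
  are at most those of \<open>\<F>\<close>.

  Let \<open>H\<close> be \<open>\<F>\<close>-free with large minimum degree. No removal lemma is needed to reach \<open>\<F>'\<close>: a
  random set of \<open>m\<close> vertices spans an \<open>\<F>'\<close>-free graph with probability close to 1, because
  otherwise \<open>H\<close> would contain a large blowup of a graph that is not \<open>\<F>'\<close>-free, and thereby a
  member of \<open>\<F>\<close>. Degree densities are martingales under the deletion of random vertices and
  concentrate exponentially, so along a random increasing chain of vertex sets of sizes
  \<open>m, \<dots>, n\<close> all minimum degrees stay large with probability at least 3/4. The first set of such a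
  chain spans a member of \<open>\<HH>\<close>, and vertex-extendability of \<open>\<F>\<close> carries this up to \<open>H\<close>.
\<close>

section \<open>Averages over subsets of fixed size\<close>

text \<open>Two losses could grow without control. A symmetrization may take many steps, but nothing
  adds up over them: each step puts back all vertices except those of low degree in the graph at
  hand, so one choice of constants serves the whole induction. Growing from \<open>m\<close> to
  \<open>n\<close> vertices takes \<open>n - m\<close> steps, each with its own failure probability;
  a union bound over the vertices of a random \<open>k\<close>-set makes it of order
  \<open>k * exp (- \<alpha> * k)\<close> with \<alpha> independent of \<open>n\<close>. These
  bounds are summable, so a constant \<open>m\<close> serves all \<open>n\<close>, and for constant
  \<open>m\<close> the sampling argument applies. Everything is normalised by binomial coefficients.
  Degrees and numbers of maps then are averages over subsets, the extremal density is monotone, and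
  one limit \<open>L\<close> serves both families. Probabilities are finite averages, and the random
  chain is never constructed: only the proportion of \<open>k\<close>-sets spanning no member of
  \<open>\<HH>\<close> is followed as \<open>k\<close> grows.\<close>

definition ksub :: "'a set \<Rightarrow> nat \<Rightarrow> 'a set set" where
  "ksub S k = {A. A \<subseteq> S \<and> card A = k}"

text \<open>Expectation over a uniformly random \<open>k\<close>-subset of a finite
  \<open>S\<close>; applied to \<open>of_bool\<close> of an event it is a probability. For
  \<open>k > card S\<close> there is no such subset and the value is \<open>0\<close>.\<close>

definition avg :: "('a set \<Rightarrow> real) \<Rightarrow> nat \<Rightarrow> 'a set \<Rightarrow> real" where
  "avg f k S = (\<Sum>A\<in>ksub S k. f A) / real (card S choose k)"

lemma finite_ksub [simp]: "finite S \<Longrightarrow> finite (ksub S k)"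
  by (simp add: ksub_def)

lemma card_ksub: "finite S \<Longrightarrow> card (ksub S k) = card S choose k"
  by (simp add: ksub_def n_subsets)

lemma ksub_card_self: "finite S \<Longrightarrow> ksub S (card S) = {S}"
  using card_subset_eq by (auto simp: ksub_def)

lemma avg_card_self: "finite S \<Longrightarrow> avg f (card S) S = f S"
  by (simp add: avg_def ksub_card_self)

lemma avg_mono:
  assumes "\<And>A. A \<subseteq> S \<Longrightarrow> card A = k \<Longrightarrow> f A \<le> g A"
  shows "avg f k S \<le> avg g k S"
  unfolding avg_def by (intro divide_right_mono sum_mono) (use assms in \<open>auto simp: ksub_def\<close>)

lemma avg_cong:
  assumes "\<And>A. A \<subseteq> S \<Longrightarrow> card A = k \<Longrightarrow> f A = g A"
  shows "avg f k S = avg g k S"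
  using assms by (simp add: avg_def ksub_def)

lemma avg_add: "avg (\<lambda>A. f A + g A) k S = avg f k S + avg g k S"
  by (simp add: avg_def sum.distrib add_divide_distrib)

lemma avg_cmult: "avg (\<lambda>A. c * f A) k S = c * avg f k S"
  by (simp add: avg_def sum_distrib_left)

lemma avg_const: "finite S \<Longrightarrow> k \<le> card S \<Longrightarrow> avg (\<lambda>_. c) k S = c"
  by (simp add: avg_def card_ksub)

lemma avg_nonneg: "(\<And>A. A \<subseteq> S \<Longrightarrow> card A = k \<Longrightarrow> 0 \<le> f A) \<Longrightarrow> 0 \<le> avg f k S"
  unfolding avg_def by (intro divide_nonneg_nonneg sum_nonneg) (auto simp: ksub_def)

lemma avg_le:
  assumes "finite S" "0 \<le> c" "\<And>A. A \<subseteq> S \<Longrightarrow> card A = k \<Longrightarrow> f A \<le> c"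
  shows "avg f k S \<le> c"
proof (cases "k \<le> card S")
  case True
  have "avg f k S \<le> avg (\<lambda>_. c) k S"
    by (rule avg_mono) (use assms in auto)
  with True assms show ?thesis by (simp add: avg_const)
next
  case False
  then show ?thesis using assms by (simp add: avg_def binomial_eq_0)
qed

lemma avg_obtain_ge:
  assumes "finite S" "k \<le> card S"
  obtains A where "A \<subseteq> S" "card A = k" "avg f k S \<le> f A"
proof -
  have pos: "card (ksub S k) > 0" using assms by (simp add: card_ksub)
  have "\<exists>A\<in>ksub S k. avg f k S \<le> f A"
  proof (rule ccontr)
    assume "\<not> ?thesis"
    then have "(\<Sum>A\<in>ksub S k. f A) < real (card (ksub S k)) * avg f k S"
      using pos by (intro sum_bounded_above_strict) auto
    with pos show False using assms by (simp add: avg_def card_ksub)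
  qed
  with that show ?thesis by (auto simp: ksub_def)
qed

lemma binomial_remove_one:
  assumes "s < n"
  shows "real n * real ((n - 1) choose s) = real (n - s) * real (n choose s)"
proof -
  obtain m where m: "n = Suc m" using assms by (cases n) auto
  have "Suc m * (m choose s) = (Suc m - s) * (Suc m choose s)"
    using assms m by (metis binomial_absorb_comp diff_Suc_1 diff_Suc_Suc) 
  then have "real (Suc m * (m choose s)) = real ((Suc m - s) * (Suc m choose s))" by (rule arg_cong)
  then show ?thesis unfolding m of_nat_mult by simp
qed

text \<open>The martingale property: an \<open>s\<close>-set survives the deletion of
  \<open>u\<close> for \<open>card S - s\<close> choices of \<open>u\<close>, and by
  \<open>binomial_remove_one\<close> this factor exactly offsets the change of the binomial
  coefficient.\<close>

lemma avg_remove_one: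
  assumes S: "finite S" and s: "s < card S"
  shows "(\<Sum>u\<in>S. avg f s (S - {u})) = real (card S) * avg f s S"
proof -
  have "(\<Sum>u\<in>S. \<Sum>A\<in>ksub (S - {u}) s. f A) = (\<Sum>u\<in>S. \<Sum>A\<in>{A\<in>ksub S s. u \<notin> A}. f A)"
    by (intro sum.cong refl) (auto simp: ksub_def)
  also have "\<dots> = (\<Sum>A\<in>ksub S s. \<Sum>u\<in>{u\<in>S. u \<notin> A}. f A)"
    by (rule sum.swap_restrict) (use S in auto)
  also have "\<dots> = (\<Sum>A\<in>ksub S s. real (card S - s) * f A)"
  proof (intro sum.cong refl)
    fix A assume "A \<in> ksub S s"
    then have "card {u\<in>S. u \<notin> A} = card S - s"
      using S card_Diff_subset[of A S] by (auto simp: ksub_def set_diff_eq finite_subset)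
    then show "(\<Sum>u\<in>{u\<in>S. u \<notin> A}. f A) = real (card S - s) * f A" by simp
  qed
  finally have sum: "(\<Sum>u\<in>S. \<Sum>A\<in>ksub (S - {u}) s. f A) = real (card S - s) * (\<Sum>A\<in>ksub S s. f A)"
    by (simp add: sum_distrib_left)
  have pos: "real (card S - 1 choose s) > 0" "real (card S choose s) > 0" using s by auto
  have "(\<Sum>u\<in>S. avg f s (S - {u})) = (\<Sum>u\<in>S. \<Sum>A\<in>ksub (S - {u}) s. f A) / real (card S - 1 choose s)"
    unfolding avg_def sum_divide_distrib by (intro sum.cong refl) (use S in auto)
  also have "\<dots> = real (card S) * avg f s S"
  proof -
    have "X * (c * d) / (b * d) = X * (a * b) / (b * d)" if "a * b = c * d" for X a b c d :: real
      using that by simp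
    then have "c * X / b = a * (X / d)" if "a * b = c * d" "b > 0" "d > 0" for X a b c d :: real
      using that by (simp add: field_simps)
    then show ?thesis unfolding sum avg_def using pos binomial_remove_one[OF s] by blast
  qed
  finally show ?thesis .
qed

text \<open>Iterated expectation: removing one vertex at a time reduces it to
  \<open>avg_remove_one\<close>.\<close>

lemma avg_tower:
  assumes "finite S" "k \<le> j" "j \<le> card S"
  shows "avg (avg f k) j S = avg f k S"
  using assms
proof (induction "card S" arbitrary: S)
  case 0
  then show ?case by (metis avg_card_self le_zero_eq)
next
  case (Suc n)
  show ?case
  proof (cases "j = card S")
    case True
    then show ?thesis using Suc by (simp add: avg_card_self)
  next
    case False
    then have j: "j < card S" using Suc by simp
    have "real (card S) * avg (avg f k) j S = (\<Sum>u\<in>S. avg (avg f k) j (S - {u}))"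
      using avg_remove_one[OF Suc(3) j] by simp
    also have "\<dots> = (\<Sum>u\<in>S. avg f k (S - {u}))"
      by (intro sum.cong refl Suc(1)) (use Suc(2-) j in auto)
    also have "\<dots> = real (card S) * avg f k S"
      using avg_remove_one[of S k f] Suc j by simp
    finally show ?thesis using j by simp
  qed
qed

lemma sum_ksub_containing:
  assumes S: "finite S" and "u \<in> S" "1 \<le> s"
  shows "(\<Sum>A\<in>{A\<in>ksub S s. u \<in> A}. f A) = (\<Sum>B\<in>ksub (S - {u}) (s - 1). f (insert u B))"
proof (rule sum.reindex_bij_witness[where i = "insert u" and j = "\<lambda>A. A - {u}"])
  fix A assume A: "A \<in> {A\<in>ksub S s. u \<in> A}"
  then show "insert u (A - {u}) = A" "A - {u} \<in> ksub (S - {u}) (s - 1)"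
    "f (insert u (A - {u})) = f A"
    by (auto simp: ksub_def insert_absorb)
next
  fix B assume B: "B \<in> ksub (S - {u}) (s - 1)"
  then have "u \<notin> B" "finite B" using S by (auto simp: ksub_def intro: finite_subset)
  then show "insert u B - {u} = B" "insert u B \<in> {A\<in>ksub S s. u \<in> A}"
    using B assms by (auto simp: ksub_def)
qed

text \<open>With \<open>n = card S\<close>, the difference is \<open>avg f s S * s / (n - s)\<close>
  minus the normalised contribution of the sets through \<open>u\<close>. Both terms lie between
  \<open>0\<close> and \<open>M * s / (n - s)\<close>, so subtracting them costs no factor
  2.\<close>

lemma avg_remove_bound:
  fixes f :: "'a set \<Rightarrow> real"
  assumes S: "finite S" and u: "u \<in> S" and s: "s < card S"
    and f: "\<And>A. 0 \<le> f A" "\<And>A. f A \<le> M"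
  shows "\<bar>avg f s (S - {u}) - avg f s S\<bar> \<le> M * real s / real (card S - s)"
proof -
  define n where "n = card S"
  define N where "N = (\<Sum>A\<in>ksub S s. f A)"
  define h where "h = (\<Sum>A\<in>{A\<in>ksub S s. u \<in> A}. f A)"
  have M: "0 \<le> M" using f[of undefined] by linarith
  have pos: "real (n - 1 choose s) > 0" "real (n choose s) > 0" "real (n - s) > 0"
    using s by (auto simp: n_def)
  have eq: "real n * real (n - 1 choose s) = real (n - s) * real (n choose s)"
    using binomial_remove_one s n_def by blast
  have "N = h + (\<Sum>A\<in>{A\<in>ksub S s. u \<notin> A}. f A)"
    unfolding N_def h_def
    by (subst sum.union_disjoint[symmetric]) (use S in \<open>auto intro!: sum.cong\<close>)
  moreover have "{A\<in>ksub S s. u \<notin> A} = ksub (S - {u}) s" by (auto simp: ksub_def)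
  ultimately have avg': "avg f s (S - {u}) = (N - h) / real (n - 1 choose s)"
    using S u by (simp add: avg_def n_def)
  have avgS: "avg f s S = N / real (n choose s)" by (simp add: avg_def N_def n_def)
  have bounds: "0 \<le> N / real (n choose s)" "N / real (n choose s) \<le> M"
    using avg_nonneg[of S s f] avg_le[OF S M, of s f] f avgS by auto
  have d1: "N / real (n - 1 choose s) - N / real (n choose s) = N / real (n choose s) * real s / real (n - s)"
  proof -
    have "N / real (n - 1 choose s) = N * real n / (real (n - s) * real (n choose s))"
      unfolding eq[symmetric] using pos s by (simp add: n_def)
    moreover have "N * (e + \<sigma>) / (e * d) - N / d = N / d * \<sigma> / e" if "e > 0" "d > 0" for e d \<sigma> :: real
      using that by (simp add: field_simps)
    moreover have "real n = real (n - s) + real s" using s by (simp add: n_def)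
    ultimately show ?thesis using pos by presburger
  qed
  have h0: "0 \<le> h" unfolding h_def by (intro sum_nonneg) (use f in auto)
  have h1: "h / real (n - 1 choose s) \<le> M * real s / real (n - s)"
  proof (cases "s = 0")
    case True
    then have "{A\<in>ksub S s. u \<in> A} = {}" using S by (auto simp: ksub_def dest: finite_subset)
    then have "h = 0" unfolding h_def by (simp only: sum.empty)
    then show ?thesis using True by simp
  next
    case False
    have "h = (\<Sum>B\<in>ksub (S - {u}) (s - 1). f (insert u B))"
      unfolding h_def by (rule sum_ksub_containing) (use S u False in auto)
    also have "\<dots> \<le> (\<Sum>B\<in>ksub (S - {u}) (s - 1). M)"
      by (intro sum_mono f)
    also have "\<dots> = M * real (n - 1 choose (s - 1))"
      using S u by (simp add: card_ksub n_def)
    finally have "h \<le> M * real (n - 1 choose (s - 1))" .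
    moreover have "real (n - 1 choose (s - 1)) * real (n - s) = real s * real (n - 1 choose s)"
    proof -
      obtain t where t: "s = Suc t" using False by (cases s) auto
      have "(n - 1 choose t) * (n - 1 - t) = Suc t * (n - 1 choose Suc t)"
        using binomial_absorb_comp[of "n - 1" t] binomial_absorption[of t "n-1"]
        by (simp add: mult.commute)
      then have "real ((n - 1 choose t) * (n - 1 - t)) = real (Suc t * (n - 1 choose Suc t))" by (rule arg_cong)
      then show ?thesis unfolding t of_nat_mult by simp
    qed
    ultimately have "h * real (n - s) \<le> M * real s * real (n - 1 choose s)"
      using pos by (metis mult.assoc mult_right_mono of_nat_0_le_iff)
    then show ?thesis using pos by (simp add: field_simps)
  qed
  have "N / real (n choose s) * real s / real (n - s) \<le> M * real s / real (n - s)"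
    using bounds by (intro divide_right_mono mult_right_mono) auto
  moreover have "0 \<le> N / real (n choose s) * real s / real (n - s)"
    by (rule divide_nonneg_nonneg[OF mult_nonneg_nonneg]) (use bounds in auto)
  moreover have "0 \<le> h / real (n - 1 choose s)" using h0 by simp
  moreover have "avg f s (S - {u}) - avg f s S =
      N / real (n choose s) * real s / real (n - s) - h / real (n - 1 choose s)"
    unfolding avg' avgS d1[symmetric] by (simp add: diff_divide_distrib)
  moreover have "\<bar>x - y\<bar> \<le> B" if "0 \<le> x" "x \<le> B" "0 \<le> y" "y \<le> B" for x y B :: real
    using that by linarith
  ultimately show ?thesis using h1 unfolding n_def[symmetric] by presburger
qed

text \<open>The vertices of \<open>W - W'\<close> are deleted one at a time. Before each deletion
  the set has more than \<open>card W'\<close> elements, hence the \<open>+ 1\<close> in the common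
  denominator.\<close>

lemma avg_subset_bound:
  fixes f :: "'a set \<Rightarrow> real"
  assumes "finite W" "W' \<subseteq> W" "s \<le> card W'"
    and f: "\<And>A. 0 \<le> f A" "\<And>A. f A \<le> M"
  shows "\<bar>avg f s W' - avg f s W\<bar> \<le> real (card (W - W')) * (M * real s / real (card W' + 1 - s))"
proof -
  define D where "D = M * real s / real (card W' + 1 - s)"
  have "\<bar>avg f s W' - avg f s W\<bar> \<le> real (card (W - W')) * D"
    using assms(1-3)
  proof (induction "card (W - W')" arbitrary: W)
    case 0
    then have "W = W'" by auto
    then show ?case by simp
  next
    case (Suc n)
    then obtain u where u: "u \<in> W - W'" by (metis card.empty ex_in_conv nat.distinct(1))
    have M: "0 \<le> M" using f[of undefined] by linarith
    have c: "card (W - {u} - W') = n" using Suc u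
      by (metis Diff_insert Diff_insert2 card_Diff_singleton diff_Suc_1 )
    have le: "card W' \<le> card (W - {u})" using Suc u by (intro card_mono) auto
    then have cW: "card W' + 1 \<le> card W" using u Suc by (simp add: card_Diff_singleton) (metis Suc_pred card_gt_0_iff empty_iff not_less_eq_eq)
    have IH: "\<bar>avg f s W' - avg f s (W - {u})\<bar> \<le> real n * D"
      using Suc(1)[of "W - {u}"] c Suc(3-) u by (auto simp: D_def)
    have "\<bar>avg f s (W - {u}) - avg f s W\<bar> \<le> M * real s / real (card W - s)"
      by (rule avg_remove_bound) (use Suc(3-) u f cW in auto)
    also have "\<dots> \<le> D"
      unfolding D_def using cW Suc(5) M by (intro divide_left_mono) auto
    finally have "\<bar>avg f s W' - avg f s W\<bar> \<le> real n * D + D"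
      using IH by linarith
    also have "\<dots> = real (card (W - W')) * D"
      using Suc(2) by (simp flip: Suc(2) add: algebra_simps)
    finally show ?case .
  qed
  then show ?thesis by (simp add: D_def)
qed

section \<open>Exponential concentration of averages over random subsets\<close>

lemma exp_le_quadratic:
  fixes x :: real
  assumes "\<bar>x\<bar> \<le> 1"
  shows "exp x \<le> 1 + x + x\<^sup>2"
proof (cases "0 \<le> x")
  case True
  then show ?thesis using assms exp_bound by auto
next
  case False
  define y where "y = - x"
  have y: "0 < y" using False y_def by simp
  have "(1 + y) * (1 - y + y\<^sup>2) = 1 + y ^ 3" by (simp add: algebra_simps power2_eq_square power3_eq_cube)
  also have "\<dots> \<ge> 1" using y by simp
  finally have "1 / (1 + y) \<le> 1 - y + y\<^sup>2" using y by (simp add: field_simps)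
  moreover have "exp x \<le> 1 / (1 + y)"
    using exp_ge_add_one_self[of y] y unfolding y_def by (simp add: exp_minus field_simps)
  ultimately show ?thesis unfolding y_def by simp
qed

text \<open>Deleting random vertices one at a time makes \<open>avg f s\<close> a martingale whose increment at a
  set of size \<open>j\<close> is at most \<open>c / (j - s)\<close>; the sum of the squared increments telescopes.\<close>

lemma avg_exp_bound:
  fixes f :: "'a set \<Rightarrow> real"
  assumes "finite W" "s < k" "k \<le> card W"
    and f: "\<And>A. 0 \<le> f A" "\<And>A. f A \<le> M"
    and c: "M * real s \<le> c" and lam: "0 \<le> \<tau>" "\<tau> * c \<le> real (k - s)"
  shows "avg (\<lambda>S. exp (- \<tau> * avg f s S)) k W
     \<le> exp (- \<tau> * avg f s W + \<tau>\<^sup>2 * c\<^sup>2 * (1 / real (k - s) - 1 / real (card W - s)))"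
  using assms(1-3)
proof (induction "card W" arbitrary: W)
  case 0
  then show ?case by simp
next
  case (Suc n)
  let ?F = "\<lambda>S. exp (- \<tau> * avg f s S)"
  show ?case
  proof (cases "k = card W")
    case True
    then show ?thesis using Suc by (simp add: avg_card_self)
  next
    case False
    then have k: "k < card W" "k \<le> n" using Suc by auto
    have M: "0 \<le> M" using f[of undefined] by linarith
    have c0: "0 \<le> c" using M c by (meson mult_nonneg_nonneg of_nat_0_le_iff order_trans)
    \<comment> \<open>\<open>K\<close> is the variance term from the induction hypothesis for sets
      of size \<open>n = card W - 1\<close>, and \<open>b\<close> bounds \<tau> times one increment.
      The assumption on \<tau> gives \<open>b \<le> 1\<close>, as \<open>exp_le_quadratic\<close>
      requires.\<close>
    define K where "K = \<tau>\<^sup>2 * c\<^sup>2 * (1 / real (k - s) - 1 / real (n - s))"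
    define b where "b = \<tau> * c / real (card W - s)"
    define x where "x u = - \<tau> * (avg f s (W - {u}) - avg f s W)" for u
    have b1: "b \<le> 1" using lam k Suc(4) unfolding b_def by (simp add: field_simps)
    have b0: "0 \<le> b" using lam c0 by (simp add: b_def)
    have x: "\<bar>x u\<bar> \<le> b" if "u \<in> W" for u
    proof -
      have "\<bar>avg f s (W - {u}) - avg f s W\<bar> \<le> M * real s / real (card W - s)"
        by (rule avg_remove_bound) (use Suc(3-) k f that in auto)
      also have "\<dots> \<le> c / real (card W - s)" using c by (intro divide_right_mono) auto
      finally show ?thesis unfolding x_def b_def abs_mult abs_minus_cancel
        using lam mult_left_mono[of _ _ \<tau>] by fastforce
    qed
    have "(\<Sum>u\<in>W. exp (x u)) \<le> (\<Sum>u\<in>W. 1 + x u + b\<^sup>2)"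
    proof (rule sum_mono)
      fix u assume u: "u \<in> W"
      have "exp (x u) \<le> 1 + x u + (x u)\<^sup>2"
        using x[OF u] b1 by (intro exp_le_quadratic) auto
      moreover have "(x u)\<^sup>2 \<le> b\<^sup>2" using x[OF u] b0 by (metis abs_le_square_iff abs_of_nonneg)
      ultimately show "exp (x u) \<le> 1 + x u + b\<^sup>2" by linarith
    qed
    also have "\<dots> = real (card W) * (1 + b\<^sup>2) + (\<Sum>u\<in>W. x u)"
      by (simp add: sum.distrib algebra_simps)
    \<comment> \<open>The increments average to zero, so only the quadratic term survives.\<close>
    also have "(\<Sum>u\<in>W. x u) = 0"
    proof -
      have "(\<Sum>u\<in>W. x u) = - \<tau> * ((\<Sum>u\<in>W. avg f s (W - {u})) - real (card W) * avg f s W)"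
        unfolding x_def by (simp add: sum_distrib_left[symmetric] sum_subtractf del: mult_minus_left)
      then show ?thesis using avg_remove_one[of W s f] Suc(3-) k by simp
    qed
    also have "real (card W) * (1 + b\<^sup>2) + 0 \<le> real (card W) * exp (b\<^sup>2)"
      by (simp add: mult_left_mono)
    finally have sx: "(\<Sum>u\<in>W. exp (x u)) \<le> real (card W) * exp (b\<^sup>2)" .
    have "real (card W) * avg ?F k W = (\<Sum>u\<in>W. avg ?F k (W - {u}))"
      using avg_remove_one[OF Suc(3) k(1)] by simp
    also have "\<dots> \<le> (\<Sum>u\<in>W. exp (- \<tau> * avg f s (W - {u}) + K))"
    proof (rule sum_mono)
      fix u assume "u \<in> W"
      then have cn: "card (W - {u}) = n" using Suc(2,3) by (metis card_Diff_singleton diff_Suc_1)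
      show "avg ?F k (W - {u}) \<le> exp (- \<tau> * avg f s (W - {u}) + K)"
        using Suc(1)[of "W - {u}"] Suc(3-) k cn unfolding K_def by simp
    qed
    also have "\<dots> = exp (- \<tau> * avg f s W + K) * (\<Sum>u\<in>W. exp (x u))"
      unfolding sum_distrib_left by (intro sum.cong refl) (simp add: x_def algebra_simps flip: exp_add)
    also have "\<dots> \<le> exp (- \<tau> * avg f s W + K) * (real (card W) * exp (b\<^sup>2))"
      using sx by (intro mult_left_mono) auto
    finally have "avg ?F k W \<le> exp (- \<tau> * avg f s W + K + b\<^sup>2)"
      using k by (simp add: exp_add mult.commute mult.left_commute)
    also have "\<dots> \<le> exp (- \<tau> * avg f s W + \<tau>\<^sup>2 * c\<^sup>2 * (1 / real (k - s) - 1 / real (card W - s)))"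
    proof -
      define a where "a = real (n - s)"
      have a: "a > 0" "real (card W - s) = a + 1" using k Suc(2,4) unfolding a_def by auto
      have "1 / (a + 1)\<^sup>2 \<le> 1 / a - 1 / (a + 1)"
      proof -
        have "1 / a - 1 / (a + 1) = 1 / (a * (a + 1))" using a by (simp add: field_simps)
        then show ?thesis using a frac_le[of 1 1 "a * (a + 1)" "(a + 1)\<^sup>2"]
          by (simp add: power2_eq_square)
      qed
      then have "\<tau>\<^sup>2 * c\<^sup>2 * (1 / (a + 1)\<^sup>2) \<le> \<tau>\<^sup>2 * c\<^sup>2 * (1 / a - 1 / (a + 1))"
        by (intro mult_left_mono) auto
      then show ?thesis unfolding K_def b_def a_def[symmetric] a(2)
        by (simp add: power_divide power_mult_distrib algebra_simps)
    qed
    finally show ?thesis .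
  qed
qed

text \<open>Markov's inequality for the exponential moment. The bound involves \<open>k - s\<close>
  but not \<open>card W\<close>; this uniformity later allows a constant sample size.
  \<open>c\<close> is kept apart from \<open>M * s\<close> because it must be positive and at least
  \<open>t\<close>.\<close>

lemma avg_concentration:
  fixes f :: "'a set \<Rightarrow> real"
  assumes W: "finite W" "s < k" "k \<le> card W"
    and f: "\<And>A. 0 \<le> f A" "\<And>A. f A \<le> M"
    and c: "M * real s \<le> c" "0 < t" "t \<le> c"
  shows "avg (\<lambda>S. of_bool (avg f s S < avg f s W - t)) k W \<le> exp (- (t\<^sup>2 / (4 * c\<^sup>2)) * real (k - s))"
proof -
  \<comment> \<open>This \<tau> minimises
    \<open>- \<tau> * t + \<tau>\<^sup>2 * c\<^sup>2 / (k - s)\<close>; it is admissible because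
    \<open>t \<le> c\<close>.\<close>
  define \<tau> where "\<tau> = t / (2 * c\<^sup>2) * real (k - s)"
  have c0: "c > 0" using c by linarith
  have l0: "0 \<le> \<tau>" using c unfolding \<tau>_def by simp
  have "t / (2 * c\<^sup>2) * c \<le> 1" using c c0 by (simp add: power2_eq_square field_simps)
  then have "t / (2 * c\<^sup>2) * c * real (k - s) \<le> 1 * real (k - s)"
    by (intro mult_right_mono) auto
  then have l1: "\<tau> * c \<le> real (k - s)" unfolding \<tau>_def by (simp add: mult.commute mult.left_commute)
  have "avg (\<lambda>S. of_bool (avg f s S < avg f s W - t)) k W
      \<le> avg (\<lambda>S. exp (\<tau> * (avg f s W - t)) * exp (- \<tau> * avg f s S)) k W"
  proof (rule avg_mono)
    fix S
    have "0 \<le> \<tau> * (avg f s W - t - avg f s S)" if "avg f s S < avg f s W - t"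
      using that l0 by (intro mult_nonneg_nonneg) auto
    then show "of_bool (avg f s S < avg f s W - t) \<le> exp (\<tau> * (avg f s W - t)) * exp (- \<tau> * avg f s S)"
      by (auto simp: exp_add[symmetric] algebra_simps simp del: exp_le_one_iff)
  qed
  also have "\<dots> = exp (\<tau> * (avg f s W - t)) * avg (\<lambda>S. exp (- \<tau> * avg f s S)) k W"
    by (rule avg_cmult)
  also have "\<dots> \<le> exp (\<tau> * (avg f s W - t)) *
      exp (- \<tau> * avg f s W + \<tau>\<^sup>2 * c\<^sup>2 * (1 / real (k - s) - 1 / real (card W - s)))"
    by (intro mult_left_mono avg_exp_bound[where M = M]) (use assms l0 l1 in auto)
  also have "\<dots> = exp (- \<tau> * t + \<tau>\<^sup>2 * c\<^sup>2 * (1 / real (k - s) - 1 / real (card W - s)))"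
    by (simp add: exp_add[symmetric] algebra_simps)
  also have "\<dots> \<le> exp (- \<tau> * t + \<tau>\<^sup>2 * c\<^sup>2 * (1 / real (k - s)))"
    using mult_left_mono[of "1 / real (k - s) - 1 / real (card W - s)" "1 / real (k - s)" "\<tau>\<^sup>2 * c\<^sup>2"] by simp
  also have "- \<tau> * t + \<tau>\<^sup>2 * c\<^sup>2 * (1 / real (k - s)) = - (t\<^sup>2 / (4 * c\<^sup>2)) * real (k - s)"
    unfolding \<tau>_def using c0 W(2) by (simp add: power2_eq_square field_simps)
  finally show ?thesis .
qed

section \<open>Blowups and small samples\<close>

text \<open>Erdos' argument for dense partite hypergraphs, phrased for sets of functions so that
  coordinates can be split off by induction. A sample \<open>X0\<close> of constant size is enough
  for coordinate \<open>i\<close>: a positive proportion of the partial functions have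
  \<open>t\<close> good extensions in \<open>X0\<close>, and one of at most \<open>2 ^ M\<close>
  subsets \<open>T\<close> serves many of them.\<close>

lemma box_theorem:
  fixes I :: "'i set"
  assumes "finite I" "0 < \<delta>"
  shows "\<exists>n0. \<forall>(X :: 'a set) R. finite X \<longrightarrow> n0 \<le> card X \<longrightarrow> R \<subseteq> (I \<rightarrow>\<^sub>E X) \<longrightarrow>
     \<delta> * real (card X) ^ card I \<le> real (card R) \<longrightarrow>
     (\<exists>A. (\<forall>i\<in>I. A i \<subseteq> X \<and> card (A i) = t) \<and> PiE I A \<subseteq> R)"
  using assms
proof (induction I arbitrary: \<delta> rule: finite_induct)
  case empty
  have "PiE {} A \<subseteq> R" if "R \<subseteq> ({} \<rightarrow>\<^sub>E X)" "\<delta> * real (card X) ^ card {} \<le> real (card R)"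
    for X :: "'a set" and R :: "('i \<Rightarrow> 'a) set" and A
  proof -
    have "card R \<noteq> 0" using that(2) empty by auto
    then have "R \<noteq> {}" by auto
    with that(1) show ?thesis by auto
  qed
  then show ?case by blast
next
  case (insert i I)
  \<comment> \<open>\<open>M\<close> is so large that partial functions with fewer than
    \<open>t\<close> extensions account for at most half of the pairs that density \<delta>
    guarantees.\<close>
  define M where "M = nat \<lceil>2 * real (Suc t) / \<delta>\<rceil>"
  have Mt: "real t \<le> \<delta> * real M / 2"
  proof -
    have "2 * real (Suc t) / \<delta> \<le> real M" unfolding M_def by linarith
    then show ?thesis using insert(4) by (simp add: field_simps)
  qed
  have M1: "1 \<le> M"
  proof -
    have "0 < 2 * real (Suc t) / \<delta>" using insert(4) by simp
    then show ?thesis unfolding M_def by linarith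
  qed
  have "0 < \<delta> / 4 / 2 ^ M" using insert(4) by simp
  from insert(3)[OF this] obtain n1 where n1: "\<forall>(X :: 'a set) R. finite X \<longrightarrow> n1 \<le> card X \<longrightarrow> R \<subseteq> (I \<rightarrow>\<^sub>E X) \<longrightarrow>
     (\<delta> / 4 / 2 ^ M) * real (card X) ^ card I \<le> real (card R) \<longrightarrow>
     (\<exists>A. (\<forall>i\<in>I. A i \<subseteq> X \<and> card (A i) = t) \<and> PiE I A \<subseteq> R)" ..
  have "\<exists>A. (\<forall>j\<in>insert i I. A j \<subseteq> X \<and> card (A j) = t) \<and> PiE (insert i I) A \<subseteq> R"
    if X: "finite X" "n1 + M \<le> card X" and R: "R \<subseteq> (insert i I \<rightarrow>\<^sub>E X)"
      and dens: "\<delta> * real (card X) ^ card (insert i I) \<le> real (card R)"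
    for X :: "'a set" and R :: "('i \<Rightarrow> 'a) set"
  proof -
    define n where "n = real (card X)"
    define k where "k = card I"
    have n: "n \<ge> 1" using X(2) M1 unfolding n_def by simp
    define P where "P = (I \<rightarrow>\<^sub>E X)"
    have finP: "finite P" unfolding P_def using insert(1) X by (intro finite_PiE) auto
    have cardP: "real (card P) = n ^ k" unfolding P_def using insert(1) by (simp add: card_PiE n_def k_def)
    define Rx where "Rx x = {\<psi>\<in>P. \<psi>(i := x) \<in> R}" for x
    have finRx: "finite (Rx x)" for x using finP by (simp add: Rx_def)
    have "R = (\<lambda>(x, \<psi>). \<psi>(i := x)) ` Sigma X Rx"
    proof (intro equalityI subsetI)
      fix \<phi> assume \<phi>: "\<phi> \<in> R"
      then have \<phi>X: "\<phi> \<in> (insert i I \<rightarrow>\<^sub>E X)" using R by auto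
      then have "\<phi>(i := undefined) \<in> P" unfolding P_def
        using insert(2) by (auto simp: PiE_iff extensional_def)
      then have "(\<phi> i, \<phi>(i := undefined)) \<in> Sigma X Rx" using \<phi> \<phi>X by (auto simp: Rx_def)
      then show "\<phi> \<in> (\<lambda>(x, \<psi>). \<psi>(i := x)) ` Sigma X Rx"
        by (intro image_eqI[where x = "(\<phi> i, \<phi>(i := undefined))"]) auto
    qed (auto simp: Rx_def)
    moreover have "inj_on (\<lambda>(x, \<psi>). \<psi>(i := x)) (Sigma X Rx)"
    proof (intro inj_onI, clarify)
      fix x \<psi> y \<psi>'
      assume *: "\<psi> \<in> Rx x" "\<psi>' \<in> Rx y" "\<psi>(i := x) = \<psi>'(i := y)"
      then have "\<psi> i = undefined" "\<psi>' i = undefined"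
        using insert(2) by (auto simp: Rx_def P_def PiE_iff extensional_def)
      with *(3) show "x = y \<and> \<psi> = \<psi>'"
        by (metis fun_upd_same fun_upd_triv fun_upd_upd)
    qed
    ultimately have "card R = card (Sigma X Rx)" by (metis card_image)
    then have cR: "card R = (\<Sum>x\<in>X. card (Rx x))" using X finRx by simp
    define g where "g A = (\<Sum>x\<in>A. real (card (Rx x)))" for A
    have avg1: "avg g 1 A = g A / real (card A)" if "finite A" for A
    proof -
      have "ksub A 1 = (\<lambda>x. {x}) ` A" by (auto simp: ksub_def card_1_singleton_iff)
      then have "(\<Sum>B\<in>ksub A 1. g B) = g A" by (simp add: sum.reindex g_def)
      then show ?thesis by (simp add: avg_def)
    qed
    \<comment> \<open>Some \<open>M\<close>-subset does at least as well as the average over all of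
      them, and by \<open>avg_tower\<close> that average equals the one over single points.\<close>
    obtain X0 where X0: "X0 \<subseteq> X" "card X0 = M" "avg (avg g 1) M X \<le> avg g 1 X0"
      using avg_obtain_ge[of X M "avg g 1"] X by auto
    have finX0: "finite X0" using X0 X finite_subset by blast
    have "avg g 1 X \<le> avg g 1 X0" using X0(3) avg_tower[of X 1 M g] X M1 by simp
    then have "g X / n \<le> g X0 / real M" using avg1 X finX0 X0(2) by (simp add: n_def)
    moreover have "\<delta> * n ^ Suc k \<le> g X"
      using dens insert(1,2) by (simp add: cR g_def n_def k_def)
    then have "\<delta> * n ^ k \<le> g X / n" using n by (simp add: field_simps)
    ultimately have "\<delta> * n ^ k \<le> g X0 / real M" by linarith
    then have gX0: "\<delta> * n ^ k * real M \<le> g X0" using M1 by (simp add: le_divide_eq)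
    define Y where "Y = {\<psi>\<in>P. t \<le> card {x\<in>X0. \<psi> \<in> Rx x}}"
    have finY: "finite Y" using finP by (simp add: Y_def)
    have "g X0 = real (\<Sum>x\<in>X0. card {\<psi>\<in>P. \<psi> \<in> Rx x})"
      unfolding g_def of_nat_sum by (intro sum.cong refl arg_cong[where f = real] arg_cong[where f = card]) (auto simp: Rx_def)
    also have "(\<Sum>x\<in>X0. card {\<psi>\<in>P. \<psi> \<in> Rx x}) = (\<Sum>\<psi>\<in>P. card {x\<in>X0. \<psi> \<in> Rx x})"
      using sum.swap_restrict[OF finX0 finP, of "\<lambda>_ _. 1::nat" "\<lambda>x \<psi>. \<psi> \<in> Rx x"] by simp
    also have "\<dots> \<le> (\<Sum>\<psi>\<in>P. (if \<psi> \<in> Y then M else 0) + t)"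
    proof (rule sum_mono)
      fix \<psi> assume "\<psi> \<in> P"
      moreover have "card {x\<in>X0. \<psi> \<in> Rx x} \<le> M"
        unfolding X0(2)[symmetric] by (intro card_mono finX0) auto
      ultimately show "card {x\<in>X0. \<psi> \<in> Rx x} \<le> (if \<psi> \<in> Y then M else 0) + t"
        by (auto simp: Y_def)
    qed
    also have "\<dots> = card Y * M + card P * t"
    proof -
      have "P \<inter> Y = Y" by (auto simp: Y_def)
      then show ?thesis using finP by (simp add: sum.distrib flip: sum.inter_restrict)
    qed
    finally have "g X0 \<le> real (card Y) * real M + n ^ k * real t" by (simp flip: cardP of_nat_mult of_nat_add)
    also have "n ^ k * real t \<le> n ^ k * (\<delta> * real M / 2)"
      using Mt n by (intro mult_left_mono) auto
    finally have "\<delta> / 2 * n ^ k * real M \<le> real (card Y) * real M"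
      using gX0 by (simp add: algebra_simps)
    then have Y: "\<delta> / 2 * n ^ k \<le> real (card Y)" using M1 by simp
    define RT where "RT T = {\<psi>\<in>P. \<forall>x\<in>T. \<psi> \<in> Rx x}" for T
    \<comment> \<open>Pigeonhole over the \<open>t\<close>-subsets of \<open>X0\<close>. The
      constant is half of what pigeonhole gives, so that failure is a strict contradiction.\<close>
    have "\<exists>T\<in>ksub X0 t. \<delta> / 4 / 2 ^ M * n ^ k \<le> real (card (RT T))"
    proof (rule ccontr)
      assume no: "\<not> ?thesis"
      have "Y \<subseteq> (\<Union>T\<in>ksub X0 t. RT T)"
      proof
        fix \<psi> assume \<psi>: "\<psi> \<in> Y"
        then obtain T where "T \<subseteq> {x\<in>X0. \<psi> \<in> Rx x}" "card T = t"
          unfolding Y_def using obtain_subset_with_card_n by blast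
        with \<psi> show "\<psi> \<in> (\<Union>T\<in>ksub X0 t. RT T)" by (auto simp: ksub_def RT_def Y_def)
      qed
      moreover have "finite (\<Union>T\<in>ksub X0 t. RT T)" using finX0 finP by (auto simp: RT_def)
      ultimately have "card Y \<le> card (\<Union>T\<in>ksub X0 t. RT T)" by (intro card_mono)
      also have "\<dots> \<le> (\<Sum>T\<in>ksub X0 t. card (RT T))" using finX0 by (intro card_UN_le) auto
      finally have "real (card Y) \<le> (\<Sum>T\<in>ksub X0 t. real (card (RT T)))"
        by (simp flip: of_nat_sum)
      also have "\<dots> \<le> real (card (ksub X0 t)) * (\<delta> / 4 / 2 ^ M * n ^ k)"
        by (rule sum_bounded_above) (use no in auto)
      also have "\<dots> \<le> 2 ^ M * (\<delta> / 4 / 2 ^ M * n ^ k)"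
      proof (rule mult_right_mono)
        have "card (ksub X0 t) \<le> card (Pow X0)" using finX0 by (intro card_mono) (auto simp: ksub_def)
        then show "real (card (ksub X0 t)) \<le> 2 ^ M" using finX0 X0(2)
          by (simp add: card_Pow flip: of_nat_le_iff)
      qed (use n insert(4) in auto)
      also have "\<dots> = \<delta> / 4 * n ^ k" by simp
      finally have "\<delta> / 2 * n ^ k \<le> \<delta> / 4 * n ^ k" using Y by linarith
      moreover have "\<delta> * n ^ k > 0" using n insert(4) by simp
      ultimately show False by linarith
    qed
    then obtain T where T: "T \<subseteq> X0" "card T = t" "\<delta> / 4 / 2 ^ M * n ^ k \<le> real (card (RT T))"
      by (auto simp: ksub_def)
    have "\<exists>A. (\<forall>j\<in>I. A j \<subseteq> X \<and> card (A j) = t) \<and> PiE I A \<subseteq> RT T"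
      by (rule n1[rule_format]) (use X T in \<open>auto simp: RT_def P_def n_def k_def\<close>)
    then obtain A where A: "\<forall>j\<in>I. A j \<subseteq> X \<and> card (A j) = t" "PiE I A \<subseteq> RT T" by blast
    have "PiE (insert i I) (A(i := T)) \<subseteq> R"
    proof
      fix \<phi> assume \<phi>: "\<phi> \<in> PiE (insert i I) (A(i := T))"
      then have "\<phi>(i := undefined) \<in> PiE I A"
        using insert(2) by (auto simp: PiE_iff extensional_def split: if_splits)
      then have "\<phi>(i := undefined) \<in> RT T" using A(2) by blast
      moreover have "\<phi> i \<in> T" using \<phi> by (auto simp: PiE_iff)
      ultimately have "\<phi>(i := undefined) \<in> Rx (\<phi> i)" by (simp add: RT_def)
      then show "\<phi> \<in> R" by (simp add: Rx_def)
    qed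
    moreover have "\<forall>j\<in>insert i I. (A(i := T)) j \<subseteq> X \<and> card ((A(i := T)) j) = t"
      using A(1) T X0(1) insert(2) by auto
    ultimately show ?thesis by blast
  qed
  then show ?case by blast
qed

section \<open>Induced subgraphs and injective homomorphisms\<close>

definition induced :: "hypergraph \<Rightarrow> nat set \<Rightarrow> hypergraph" where
  "induced H S = \<lparr>verts = S, edges = {e \<in> edges H. e \<subseteq> S}\<rparr>"

lemma verts_induced [simp]: "verts (induced H S) = S"
  by (simp add: induced_def)

lemma edges_induced [simp]: "edges (induced H S) = {e \<in> edges H. e \<subseteq> S}"
  by (simp add: induced_def)

lemma rgraph_induced: "rgraph r H \<Longrightarrow> S \<subseteq> verts H \<Longrightarrow> rgraph r (induced H S)"
  by (auto simp: rgraph_def intro: finite_subset)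

lemma induced_verts: "rgraph r H \<Longrightarrow> induced H (verts H) = H"
  by (auto simp: rgraph_def intro!: hypergraph.equality)

lemma induced_induced: "T \<subseteq> S \<Longrightarrow> induced (induced H S) T = induced H T"
  unfolding induced_def by auto

lemma remove_vertex_induced: "remove_vertex (induced H S) v = induced H (S - {v})"
  by (auto simp: remove_vertex_def intro!: hypergraph.equality)

lemma hom_mono: "subgraph G H \<Longrightarrow> hom F G \<phi> \<Longrightarrow> hom F H \<phi>"
  by (auto simp: subgraph_def hom_def)

lemma free_mono: "subgraph G H \<Longrightarrow> free \<F> H \<Longrightarrow> free \<F> G"
  unfolding free_def using hom_mono by blast

lemma subgraph_induced: "S \<subseteq> verts H \<Longrightarrow> subgraph (induced H S) H"
  by (auto simp: subgraph_def)

lemma inj_homs_subset: "inj_homs Q H \<subseteq> (verts Q \<rightarrow>\<^sub>E verts H)"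
  by (auto simp: inj_homs_def hom_def PiE_def)

lemma finite_inj_homs: "finite (verts Q) \<Longrightarrow> finite (verts H) \<Longrightarrow> finite (inj_homs Q H)"
  by (rule finite_subset[OF inj_homs_subset]) (simp add: finite_PiE)

lemma hom_comp: "hom F G \<psi> \<Longrightarrow> hom G H \<phi> \<Longrightarrow> hom F H (\<phi> \<circ> \<psi>)"
  unfolding hom_def by (auto simp only: image_comp[symmetric] Pi_iff o_apply)

text \<open>High density would give a box all of whose members are injective homomorphisms, that is,
  a blowup of \<open>G\<close> in \<open>H\<close>. The colouring of \<open>F\<close> by
  \<open>G\<close> then embeds \<open>F\<close> there, each colour class going into one
  part.\<close>

lemma inj_count_small:
  assumes F: "F \<in> \<F>" "rgraph r F" and G: "rgraph r G" and "colorable G F" and \<delta>: "0 < \<delta>"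
  shows "\<exists>n0. \<forall>H. rgraph r H \<longrightarrow> free \<F> H \<longrightarrow> n0 \<le> card (verts H) \<longrightarrow>
     real (inj_count G H) < \<delta> * real (card (verts H)) ^ card (verts G)"
proof -
  obtain \<chi> where \<chi>: "hom F G \<chi>" using assms by (auto simp: colorable_def)
  have fin: "finite (verts G)" "finite (verts F)" using F G by (auto simp: rgraph_def)
  \<comment> \<open>Parts of size \<open>card (verts F)\<close> can hold any colour class;
    \<open>Suc\<close> keeps them nonempty even if \<open>F\<close> has no vertices.\<close>
  obtain n0 where n0: "\<And>(X :: nat set) R. finite X \<Longrightarrow> n0 \<le> card X \<Longrightarrow> R \<subseteq> (verts G \<rightarrow>\<^sub>E X) \<Longrightarrow>
     \<delta> * real (card X) ^ card (verts G) \<le> real (card R) \<Longrightarrow>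
     (\<exists>A. (\<forall>i\<in>verts G. A i \<subseteq> X \<and> card (A i) = Suc (card (verts F))) \<and> PiE (verts G) A \<subseteq> R)"
    using box_theorem[OF fin(1) \<delta>, where t = "Suc (card (verts F))"] by metis
  have "real (inj_count G H) < \<delta> * real (card (verts H)) ^ card (verts G)"
    if H: "rgraph r H" "free \<F> H" "n0 \<le> card (verts H)" for H
  proof (rule ccontr)
    assume "\<not> ?thesis"
    then have dens: "\<delta> * real (card (verts H)) ^ card (verts G) \<le> real (card (inj_homs G H))"
      by (simp add: inj_count_def)
    obtain A where A: "\<And>i. i \<in> verts G \<Longrightarrow> A i \<subseteq> verts H"
        "\<And>i. i \<in> verts G \<Longrightarrow> card (A i) = Suc (card (verts F))"
      and AR: "PiE (verts G) A \<subseteq> inj_homs G H"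
      using n0[OF _ H(3) inj_homs_subset dens] H(1) by (auto simp: rgraph_def)
    have finA: "finite (A i)" if "i \<in> verts G" for i using A(2)[OF that] card.infinite by fastforce
    have "\<exists>a. a \<in> A i" if "i \<in> verts G" for i using A(2)[OF that] by (metis card.empty equals0I nat.distinct(1))
    then obtain a where a: "\<And>i. i \<in> verts G \<Longrightarrow> a i \<in> A i" by metis
    \<comment> \<open>A common point of two parts would give a member of the box that takes a value
      twice.\<close>
    have disj: "A i \<inter> A j = {}" if "i \<in> verts G" "j \<in> verts G" "i \<noteq> j" for i j
    proof (rule ccontr)
      assume "A i \<inter> A j \<noteq> {}"
      then obtain x where x: "x \<in> A i" "x \<in> A j" by auto
      define \<tau> where "\<tau> = restrict (a(i := x, j := x)) (verts G)"
      have "\<tau> \<in> PiE (verts G) A" using x a by (auto simp: \<tau>_def)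
      then have "inj_on \<tau> (verts G)" using AR by (auto simp: inj_homs_def)
      then show False using that by (auto simp: \<tau>_def inj_on_def)
    qed
    have "\<exists>g. inj_on g (verts F) \<and> g ` verts F \<subseteq> A i" if "i \<in> verts G" for i
      using card_le_inj[OF fin(2) finA[OF that]] A(2)[OF that] by auto
    then obtain g where g: "\<And>i. i \<in> verts G \<Longrightarrow> inj_on (g i) (verts F) \<and> g i ` verts F \<subseteq> A i"
      by metis
    define \<theta> where "\<theta> x = g (\<chi> x) x" for x
    have \<chi>G: "\<chi> x \<in> verts G" if "x \<in> verts F" for x using \<chi> that by (auto simp: hom_def)
    have \<theta>A: "\<theta> x \<in> A (\<chi> x)" if "x \<in> verts F" for x using g[OF \<chi>G[OF that]] that by (auto simp: \<theta>_def)
    have "inj_on \<theta> (verts F)"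
    proof (rule inj_onI)
      fix x y assume xy: "x \<in> verts F" "y \<in> verts F" "\<theta> x = \<theta> y"
      then have "\<chi> x = \<chi> y" using disj[OF \<chi>G \<chi>G] \<theta>A by (metis disjoint_iff)
      then show "x = y" using xy g[OF \<chi>G[OF xy(1)]] by (auto simp: \<theta>_def inj_on_def)
    qed
    moreover have "hom F H \<theta>"
      unfolding hom_def
    proof (intro conjI ballI)
      show "\<theta> \<in> verts F \<rightarrow> verts H" using \<theta>A A(1) \<chi>G by blast
      fix e assume e: "e \<in> edges F"
      then have eF: "e \<subseteq> verts F" and ce: "card e = r" using F by (auto simp: rgraph_def)
      have \<chi>e: "\<chi> ` e \<in> edges G" using \<chi> e by (auto simp: hom_def)
      then have "card (\<chi> ` e) = card e" using G ce by (auto simp: rgraph_def)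
      \<comment> \<open>\<chi> preserves the size \<open>r\<close> of an edge, so it is injective on
        \<open>e\<close>; hence a single member \<tau> of the box can agree with \<theta> on all of
        \<open>e\<close>.\<close>
      then have inj: "inj_on \<chi> e" using eF fin by (meson eq_card_imp_inj_on finite_subset)
      define \<tau> where "\<tau> = restrict (\<lambda>i. if i \<in> \<chi> ` e then \<theta> (the_inv_into e \<chi> i) else a i) (verts G)"
      have \<tau>e: "\<tau> (\<chi> x) = \<theta> x" if "x \<in> e" for x
        using that inj eF \<chi>G by (auto simp: \<tau>_def the_inv_into_f_f)
      have "\<tau> i \<in> A i" if "i \<in> verts G" for i
      proof (cases "i \<in> \<chi> ` e")
        case True
        then show ?thesis using \<tau>e \<theta>A eF by auto
      qed (use that a in \<open>auto simp: \<tau>_def\<close>)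
      then have "\<tau> \<in> PiE (verts G) A" by (auto simp: \<tau>_def)
      then have "\<tau> ` (\<chi> ` e) \<in> edges H" using AR \<chi>e by (auto simp: inj_homs_def hom_def)
      moreover have "\<tau> ` (\<chi> ` e) = \<theta> ` e" unfolding image_image using \<tau>e by (rule image_cong[OF refl])
      ultimately show "\<theta> ` e \<in> edges H" by simp
    qed
    ultimately show False using H(2) F(1) by (auto simp: free_def)
  qed
  then show ?thesis by blast
qed

text \<open>Only finitely many graphs on \<open>{..<m}\<close> fail to be free of
  \<open>\<F>'\<close>. Some \<open>F'\<close> maps into such a \<open>G\<close> and some
  \<open>F\<close> in \<open>\<F>\<close> maps into \<open>F'\<close>, so \<open>F\<close> is
  \<open>G\<close>-colorable and \<open>inj_count_small\<close> bounds the copies of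
  \<open>G\<close>.\<close>

lemma sample_free:
  assumes le: "le_hom \<F>' \<F>" and F: "\<forall>F\<in>\<F>. rgraph r F"
    and m: "1 \<le> m" and \<delta>: "0 < \<delta>"
  shows "\<exists>n0. \<forall>H. rgraph r H \<longrightarrow> free \<F> H \<longrightarrow> n0 \<le> card (verts H) \<longrightarrow>
    avg (\<lambda>S. of_bool (\<not> free \<F>' (induced H S))) m (verts H) \<le> \<delta>"
proof -
  define \<G> where "\<G> = {G. verts G = {..<m} \<and> rgraph r G \<and> \<not> free \<F>' G}"
  have "\<G> \<subseteq> (\<lambda>E. \<lparr>verts = {..<m}, edges = E\<rparr>) ` Pow (Pow {..<m})"
  proof
    fix G :: hypergraph assume "G \<in> \<G>"
    then have "verts G = {..<m}" "edges G \<in> Pow (Pow {..<m})" by (auto simp: \<G>_def rgraph_def)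
    then show "G \<in> (\<lambda>E. \<lparr>verts = {..<m}, edges = E\<rparr>) ` Pow (Pow {..<m})"
      by (intro image_eqI[where x = "edges G"]) auto
  qed
  then have fin: "finite \<G>" by (rule finite_subset) simp
  \<comment> \<open>The factor \<open>m ^ m\<close> pays for replacing \<open>n ^ m\<close> by
    \<open>n choose m\<close>, which is at least \<open>(n / m) ^ m\<close>; the factor
    \<open>card \<G> + 1\<close> pays for the sum over \<open>\<G>\<close>.\<close>
  define \<delta>1 where "\<delta>1 = \<delta> / (real (card \<G> + 1) * real m ^ m)"
  have \<delta>1: "\<delta>1 > 0" using \<delta> m by (simp add: \<delta>1_def)
  have "\<exists>n0. \<forall>H. rgraph r H \<longrightarrow> free \<F> H \<longrightarrow> n0 \<le> card (verts H) \<longrightarrow>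
     real (inj_count G H) < \<delta>1 * real (card (verts H)) ^ card (verts G)" if "G \<in> \<G>" for G
  proof -
    have "\<not> free \<F>' G" using that by (simp add: \<G>_def)
    then obtain F' \<phi> where F': "F' \<in> \<F>'" "hom F' G \<phi>" unfolding \<G>_def free_def by blast
    obtain F \<psi> where "F \<in> \<F>" "hom F F' \<psi>" using le F' by (auto simp: le_hom_def colorable_def)
    moreover from this have "colorable G F" using hom_comp F'(2) unfolding colorable_def by blast
    ultimately show ?thesis
      by (intro inj_count_small[of _ _ r] \<delta>1) (use F that in \<open>auto simp: \<G>_def\<close>)
  qed
  then obtain n0 where n0: "\<And>G H. G \<in> \<G> \<Longrightarrow> rgraph r H \<Longrightarrow> free \<F> H \<Longrightarrow> n0 G \<le> card (verts H) \<Longrightarrow>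
     real (inj_count G H) < \<delta>1 * real (card (verts H)) ^ card (verts G)" by metis
  have "avg (\<lambda>S. of_bool (\<not> free \<F>' (induced H S))) m (verts H) \<le> \<delta>"
    if H: "rgraph r H" "free \<F> H" "sum n0 \<G> + m \<le> card (verts H)" for H
  proof -
    define n where "n = card (verts H)"
    have n: "m \<le> n" "0 < n" using H m by (auto simp: n_def)
    have finH: "finite (verts H)" using H by (simp add: rgraph_def)
    define bad where "bad = {S\<in>ksub (verts H) m. \<not> free \<F>' (induced H S)}"
    \<comment> \<open>Each bad set is the image of an embedding of a member of \<open>\<G>\<close>,
      obtained by pulling \<open>induced H S\<close> back along an enumeration of
      \<open>S\<close>.\<close>
    have "bad \<subseteq> (\<Union>G\<in>\<G>. (\<lambda>\<phi>. \<phi> ` {..<m}) ` inj_homs G H)"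
    proof
      fix S assume "S \<in> bad"
      then have S: "S \<subseteq> verts H" "card S = m" "\<not> free \<F>' (induced H S)" by (auto simp: bad_def ksub_def)
      then have "finite S" using finH finite_subset by blast
      then obtain e0 where e0: "bij_betw e0 {..<m} S"
        using S(2) ex_bij_betw_nat_finite[of S] by (auto simp: atLeast0LessThan)
      define e where "e = restrict e0 {..<m}"
      have e: "bij_betw e {..<m} S" using e0 by (simp add: e_def)
      define G where "G = \<lparr>verts = {..<m}, edges = {f. f \<subseteq> {..<m} \<and> e ` f \<in> edges H}\<rparr>"
      have inj: "inj_on e {..<m}" and im: "e ` {..<m} = S" using e by (auto simp: bij_betw_def)
      have "card f = r" if "f \<subseteq> {..<m}" "e ` f \<in> edges H" for f
        using that inj H(1) card_image[of e f] inj_on_subset by (fastforce simp: rgraph_def)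
      then have "rgraph r G" by (auto simp: rgraph_def G_def)
      moreover have "\<not> free \<F>' G"
      proof -
        obtain F \<phi> where F: "F \<in> \<F>'" "hom F (induced H S) \<phi>" "inj_on \<phi> (verts F)"
          using S(3) by (auto simp: free_def)
        define \<psi> where "\<psi> = the_inv_into {..<m} e \<circ> \<phi>"
        have \<phi>S: "\<phi> ` verts F \<subseteq> S" using F(2) by (auto simp: hom_def)
        have einv: "e (the_inv_into {..<m} e y) = y" "the_inv_into {..<m} e y < m" if "y \<in> S" for y
          using that inj im f_the_inv_into_f[of e "{..<m}" y] the_inv_into_into[of e "{..<m}" y "{..<m}"] by auto
        have "inj_on \<psi> (verts F)" unfolding \<psi>_def
          by (intro comp_inj_on F inj_on_subset[OF inj_on_the_inv_into[OF inj]]) (use im \<phi>S in auto)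
        moreover have "hom F G \<psi>"
          unfolding hom_def
        proof (intro conjI ballI)
          show "\<psi> \<in> verts F \<rightarrow> verts G" using \<phi>S einv by (auto simp: \<psi>_def G_def)
          fix f assume "f \<in> edges F"
          then have f: "\<phi> ` f \<in> edges H" "\<phi> ` f \<subseteq> S" using F(2) by (auto simp: hom_def)
          have "e ` \<psi> ` f = (\<lambda>x. \<phi> x) ` f"
            unfolding image_image using f einv by (intro image_cong refl) (auto simp: \<psi>_def)
          then show "\<psi> ` f \<in> edges G" using f einv by (auto simp: G_def \<psi>_def)
        qed
        ultimately show ?thesis using F(1) by (auto simp: free_def)
      qed
      ultimately have "G \<in> \<G>" by (simp add: \<G>_def G_def)
      moreover have "e \<in> inj_homs G H"
        using S(1) im inj by (auto simp: inj_homs_def hom_def G_def e_def)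
      ultimately show "S \<in> (\<Union>G\<in>\<G>. (\<lambda>\<phi>. \<phi> ` {..<m}) ` inj_homs G H)" using im by blast
    qed
    moreover have finI: "finite (inj_homs G H)" if "G \<in> \<G>" for G
      using that finH by (intro finite_inj_homs) (auto simp: \<G>_def)
    ultimately have "card bad \<le> card (\<Union>G\<in>\<G>. (\<lambda>\<phi>. \<phi> ` {..<m}) ` inj_homs G H)"
      using fin by (intro card_mono) auto
    also have "\<dots> \<le> (\<Sum>G\<in>\<G>. card ((\<lambda>\<phi>. \<phi> ` {..<m}) ` inj_homs G H))"
      by (rule card_UN_le[OF fin])
    also have "\<dots> \<le> (\<Sum>G\<in>\<G>. inj_count G H)"
      unfolding inj_count_def by (intro sum_mono card_image_le finI)
    finally have "real (card bad) \<le> (\<Sum>G\<in>\<G>. real (inj_count G H))" by (simp flip: of_nat_sum)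
    also have "\<dots> \<le> (\<Sum>G\<in>\<G>. \<delta>1 * real n ^ m)"
    proof (rule sum_mono)
      fix G assume G: "G \<in> \<G>"
      have "n0 G \<le> card (verts H)" using member_le_sum[OF G _ fin, of n0] H(3) by simp
      then show "real (inj_count G H) \<le> \<delta>1 * real n ^ m"
        using n0[OF G H(1,2)] G unfolding n_def \<G>_def by (simp add: less_imp_le)
    qed
    also have "\<dots> = real (card \<G>) * \<delta>1 * real n ^ m" by simp
    also have "\<dots> \<le> \<delta> * (real n / real m) ^ m"
    proof -
      have "real (card \<G>) * \<delta>1 = \<delta> / real m ^ m * (real (card \<G>) / real (card \<G> + 1))"
        unfolding \<delta>1_def by (simp add: mult.commute)
      also have "\<dots> \<le> \<delta> / real m ^ m"
        using \<delta> by (intro mult_left_le) auto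
      finally have "real (card \<G>) * \<delta>1 \<le> \<delta> / real m ^ m" .
      then show ?thesis
        using mult_right_mono[of "real (card \<G>) * \<delta>1" "\<delta> / real m ^ m" "real n ^ m"] by (simp add: power_divide)
    qed
    also have "\<dots> \<le> \<delta> * real (n choose m)"
      using binomial_ge_n_over_k_pow_k[OF n(1), where 'a = real] \<delta> by (intro mult_left_mono) auto
    finally have "real (card bad) \<le> \<delta> * real (n choose m)" .
    moreover have "(\<Sum>S\<in>ksub (verts H) m. of_bool (\<not> free \<F>' (induced H S))) = real (card bad)"
      unfolding bad_def using finH by (simp add: Int_def)
    ultimately show ?thesis using n by (simp add: avg_def n_def divide_le_eq)
  qed
  then show ?thesis by blast
qed

section \<open>Symmetrization\<close>

lemma link_notin: "e \<in> link H x \<Longrightarrow> x \<notin> e"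
  by (simp add: link_def)

lemma uncovered_sym: "uncovered H u v \<Longrightarrow> uncovered H v u"
  by (auto simp: uncovered_def)

lemma uncovered_link: "uncovered H u v \<Longrightarrow> e \<in> link H v \<Longrightarrow> u \<notin> e"
  by (auto simp: uncovered_def link_def)

lemma verts_symmetrize [simp]: "verts (symmetrize H u v) = verts H"
  by (simp add: symmetrize_def)

lemma rgraph_symmetrize:
  assumes H: "rgraph r H" and uv: "uncovered H u v"
  shows "rgraph r (symmetrize H u v)"
proof -
  have "{u} \<union> e \<subseteq> verts H \<and> card ({u} \<union> e) = r" if e: "e \<in> link H v" for e
  proof -
    have ev: "e \<union> {v} \<in> edges H" "v \<notin> e" "u \<notin> e"
      using e uncovered_link[OF uv e] by (auto simp: link_def)
    have sub: "e \<union> {v} \<subseteq> verts H" and card: "card (e \<union> {v}) = r" and "finite (verts H)"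
      using H ev(1) unfolding rgraph_def by blast+
    then have "finite (e \<union> {v})" using finite_subset by blast
    then have "card ({u} \<union> e) = r" using card ev by simp
    then show ?thesis using sub uv by (simp add: uncovered_def)
  qed
  then show ?thesis using H unfolding rgraph_def symmetrize_def by auto
qed

lemma induced_symmetrize: "u \<notin> S \<Longrightarrow> induced (symmetrize H u v) S = induced H S"
  by (auto simp: symmetrize_def intro!: hypergraph.equality)

text \<open>Replacing \<open>u\<close> by a clone of \<open>v\<close> is a blowup in which the class of \<open>u\<close> is empty.\<close>

lemma free_symmetrize:
  assumes H: "rgraph r H" and uv: "uncovered H u v" and "free \<F> H" and inv: "blowup_invariant r \<F>"
  shows "free \<F> (symmetrize H u v)"
proof -
  define V where "V = (\<lambda>i::nat. {i})(u := {}, v := {v, u})"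
  have neq: "u \<noteq> v" and mem: "u \<in> verts H" "v \<in> verts H" using uv by (auto simp: uncovered_def)
  have "disjoint_family_on V (verts H)" using neq by (auto simp: disjoint_family_on_def V_def)
  moreover have "\<forall>i\<in>verts H. finite (V i)" by (auto simp: V_def)
  ultimately have fr: "free \<F> (blowup H V)"
    using assms unfolding blowup_invariant_def by blast
  have "subgraph (symmetrize H u v) (blowup H V)"
    unfolding subgraph_def
  proof (intro conjI subsetI)
    fix x assume "x \<in> verts (symmetrize H u v)"
    then show "x \<in> verts (blowup H V)"
      using neq mem by (cases "x = u") (auto simp: blowup_def V_def)
  next
    fix E assume "E \<in> edges (symmetrize H u v)"
    then consider "E \<in> edges H" "u \<notin> E" | e where "e \<in> link H v" "E = {u} \<union> e"
      unfolding symmetrize_def by auto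
    then show "E \<in> edges (blowup H V)"
    proof cases
      case 1
      have "E \<inter> V i = {i}" if "i \<in> E" for i using that 1 by (auto simp: V_def)
      then have "\<forall>i\<in>E. card (E \<inter> V i) = 1" by simp
      moreover have "E \<subseteq> (\<Union>i\<in>E. V i)" using 1 by (auto simp: V_def)
      ultimately show ?thesis
        unfolding blowup_def hypergraph.simps by (intro CollectI bexI[OF _ 1(1)] conjI)
    next
      case 2
      have e: "v \<notin> e" "u \<notin> e" "e \<union> {v} \<in> edges H"
        using uncovered_link[OF uv 2(1)] 2(1) by (auto simp: link_def)
      have "E \<inter> V i = (if i = v then {u} else {i})" if "i \<in> e \<union> {v}" for i
        using that e(1,2) neq unfolding 2(2) by (auto simp: V_def)
      then have "\<forall>i\<in>e \<union> {v}. card (E \<inter> V i) = 1" by simp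
      moreover have "E \<subseteq> (\<Union>i\<in>e \<union> {v}. V i)" unfolding 2(2) using e(1,2) by (auto simp: V_def)
      ultimately show ?thesis
        unfolding blowup_def hypergraph.simps by (intro CollectI bexI[OF _ e(3)] conjI)
    qed
  qed
  then show ?thesis using fr free_mono by blast
qed

text \<open>Edges through \<open>u\<close> and \<open>x\<close> in the new graph come from edges
  through \<open>v\<close> and \<open>x\<close> in the old one. The criterion refers to
  \<open>x\<close> only through \<open>link H x\<close>, so vertices other than \<open>u\<close>
  with equal links keep equal links.\<close>

lemma link_symmetrize:
  assumes uv: "uncovered H u v" and "x \<noteq> u"
  shows "e \<in> link (symmetrize H u v) x \<longleftrightarrow>
    (if u \<in> e then v \<notin> e \<and> insert v (e - {u}) \<in> link H x else e \<in> link H x)"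
proof (cases "u \<in> e")
  case False
  then show ?thesis using assms(2) by (auto simp: link_def symmetrize_def)
next
  case True
  have neq: "u \<noteq> v" using uv by (auto simp: uncovered_def)
  have "e \<in> link (symmetrize H u v) x \<longleftrightarrow> x \<notin> e \<and> (\<exists>f\<in>link H v. insert x e = insert u f)"
    using True by (auto simp: link_def symmetrize_def)
  also have "\<dots> \<longleftrightarrow> x \<notin> e \<and> insert x (e - {u}) \<in> link H v"
  proof -
    have "insert x e = insert u f \<longleftrightarrow> f = insert x (e - {u})" if "f \<in> link H v" for f
    proof
      assume "insert x e = insert u f"
      then have "insert u f - {u} = insert x e - {u}" by simp
      then show "f = insert x (e - {u})"
        using uncovered_link[OF uv that] assms(2) by (simp add: insert_Diff_if)
    next
      assume "f = insert x (e - {u})"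
      then show "insert x e = insert u f" using True by (metis insert_Diff insert_commute)
    qed
    moreover have "insert x e = insert u (insert x (e - {u}))"
      using True by (metis insert_Diff insert_commute)
    ultimately show ?thesis by metis
  qed
  also have "\<dots> \<longleftrightarrow> v \<notin> e \<and> insert v (e - {u}) \<in> link H x"
  proof -
    have "insert x (e - {u}) \<in> link H v \<longleftrightarrow> x \<noteq> v \<and> v \<notin> e \<and> insert v (insert x (e - {u})) \<in> edges H"
      using neq unfolding link_def by (simp del: insert_iff) blast
    moreover have "insert v (e - {u}) \<in> link H x \<longleftrightarrow> x \<noteq> v \<and> x \<notin> e - {u} \<and> insert v (insert x (e - {u})) \<in> edges H"
      unfolding link_def by (simp add: insert_commute[of x v])
    moreover have "x \<in> e - {u} \<longleftrightarrow> x \<in> e" using assms(2) by simp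
    ultimately show ?thesis by metis
  qed
  finally show ?thesis using True by simp
qed

lemma link_symmetrize_clone:
  assumes uv: "uncovered H u v"
  shows "link (symmetrize H u v) u = link H v"
proof (intro equalityI subsetI)
  fix e assume "e \<in> link (symmetrize H u v) u"
  then have e: "u \<notin> e" "insert u e \<in> edges (symmetrize H u v)" by (simp_all add: link_def)
  then obtain f where f: "f \<in> link H v" "insert u e = insert u f"
    unfolding symmetrize_def by auto
  have "e = f" using uncovered_link[OF uv f(1)] e(1) f(2) by (simp add: insert_ident)
  with f show "e \<in> link H v" by simp
next
  fix e assume e: "e \<in> link H v"
  then have "insert u e \<in> edges (symmetrize H u v)" unfolding symmetrize_def by auto
  then show "e \<in> link (symmetrize H u v) u"
    using uncovered_link[OF uv e] by (simp add: link_def)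
qed

section \<open>Equivalent pairs as the secondary potential of symmetrization\<close>

definition equiv_class :: "hypergraph \<Rightarrow> nat \<Rightarrow> nat set" where
  "equiv_class H x = {y\<in>verts H. equivalent H x y}"

definition equiv_pairs :: "hypergraph \<Rightarrow> (nat \<times> nat) set" where
  "equiv_pairs H = {(x, y). x \<in> verts H \<and> y \<in> verts H \<and> equivalent H x y}"

lemma finite_equiv_pairs: "finite (verts H) \<Longrightarrow> finite (equiv_pairs H)"
  by (rule finite_subset[of _ "verts H \<times> verts H"]) (auto simp: equiv_pairs_def)

text \<open>No equivalence between vertices other than \<open>u\<close> is lost, and
  \<open>u\<close> joins the class of \<open>v\<close>. The ordered pairs involving \<open>u\<close>
  number \<open>2 * card (equiv_class H u) - 1\<close> before and at least
  \<open>2 * card (equiv_class H v) + 1\<close> afterwards.\<close>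

lemma card_equiv_pairs_symmetrize:
  assumes H: "finite (verts H)" and uv: "uncovered H u v" and ne: "\<not> equivalent H u v"
    and le: "card (equiv_class H u) \<le> card (equiv_class H v)"
  shows "card (equiv_pairs H) < card (equiv_pairs (symmetrize H u v))"
proof -
  let ?H = "symmetrize H u v"
  define P0 where "P0 = {(x, y)\<in>equiv_pairs H. x \<noteq> u \<and> y \<noteq> u}"
  have u: "u \<in> verts H" and v: "v \<in> verts H" using uv by (auto simp: uncovered_def)
  define star where "star C = insert (u, u) (Pair u ` C \<union> (\<lambda>x. (x, u)) ` C)" for C
  have card_star: "card (star C) = 2 * card C + 1" if "finite C" "u \<notin> C" for C
  proof -
    have "card (Pair u ` C \<union> (\<lambda>x. (x, u)) ` C) = card (Pair u ` C) + card ((\<lambda>x. (x, u)) ` C)"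
      by (rule card_Un_disjoint) (use that in auto)
    also have "\<dots> = 2 * card C" by (simp add: card_image inj_on_def)
    finally show ?thesis unfolding star_def using that by (subst card_insert_disjoint) auto
  qed
  have fin: "finite P0" "finite (equiv_class H x)" for x
    using finite_subset[OF _ finite_equiv_pairs[OF H], of P0] H by (auto simp: P0_def equiv_class_def)
  have "equiv_pairs H = P0 \<union> star (equiv_class H u - {u})"
    using u by (auto simp: P0_def star_def equiv_pairs_def equiv_class_def equivalent_def)
  moreover have disj: "P0 \<inter> star C = {}" for C by (auto simp: P0_def star_def)
  moreover have fin_star: "finite (star C)" if "finite C" for C using that by (simp add: star_def)
  ultimately have "card (equiv_pairs H) = card P0 + card (star (equiv_class H u - {u}))"
    using fin by (simp add: card_Un_disjoint)
  also have "\<dots> < card P0 + card (star (equiv_class H v))"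
  proof -
    have "u \<in> equiv_class H u" using u by (auto simp: equiv_class_def equivalent_def)
    then have "card (equiv_class H u - {u}) < card (equiv_class H u)" using fin by (intro card_Diff1_less) auto
    moreover have "u \<notin> equiv_class H v" using ne by (auto simp: equiv_class_def equivalent_def)
    ultimately show ?thesis using le fin by (simp add: card_star)
  qed
  also have "\<dots> = card (P0 \<union> star (equiv_class H v))"
    using fin fin_star disj by (simp add: card_Un_disjoint)
  also have "\<dots> \<le> card (equiv_pairs ?H)"
  proof (rule card_mono)
    show "finite (equiv_pairs ?H)" using H by (simp add: finite_equiv_pairs)
    have *: "link ?H x = link ?H y" if "link H x = link H y" "x \<noteq> u" "y \<noteq> u" for x y
      using that link_symmetrize[OF uv] by (intro set_eqI) auto
    have v_u: "v \<noteq> u" using uv by (auto simp: uncovered_def)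
    have vv: "link ?H v = link H v"
      using link_symmetrize[OF uv v_u] uncovered_link[OF uv] link_notin[of _ H v]
      by (intro set_eqI) (metis insertI1)
    have clone: "link ?H x = link ?H u" if "link H x = link H v" "x \<noteq> u" for x
      using *[of x v] that v_u vv link_symmetrize_clone[OF uv] by simp
    have "P0 \<subseteq> equiv_pairs ?H" using * by (auto simp: P0_def equiv_pairs_def equivalent_def)
    moreover have "star (equiv_class H v) \<subseteq> equiv_pairs ?H"
    proof -
      have "link ?H x = link ?H u \<and> x \<in> verts H" if "x \<in> equiv_class H v" for x
        using that clone[of x] ne by (auto simp: equiv_class_def equivalent_def)
      then show ?thesis using u by (auto simp: star_def equiv_pairs_def equivalent_def)
    qed
    ultimately show "P0 \<union> star (equiv_class H v) \<subseteq> equiv_pairs ?H" by simp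
  qed
  finally show ?thesis .
qed

text \<open>Strict growth of the count in one direction decides the choice. In a tie both directions
  keep the count, and the vertex with the smaller class becomes the clone.\<close>

lemma symmetrization_step:
  assumes H: "rgraph r H" and nsym: "\<not> symmetrized H" and inc: "symmetrization_increasing r Q"
  obtains u v where "uncovered H u v" "inj_count Q H \<le> inj_count Q (symmetrize H u v)"
    "inj_count Q H < inj_count Q (symmetrize H u v) \<or>
     card (equiv_pairs H) < card (equiv_pairs (symmetrize H u v))"
proof -
  obtain u v where uv: "uncovered H u v" "\<not> equivalent H u v"
    using nsym by (auto simp: symmetrized_def)
  note vu = uncovered_sym[OF uv(1)]
  have fin: "finite (verts H)" using H by (simp add: rgraph_def)
  have nvu: "\<not> equivalent H v u" using uv(2) by (simp add: equivalent_def)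
  from inc H uv(1) consider
      "inj_count Q H < inj_count Q (symmetrize H u v)"
    | "inj_count Q H < inj_count Q (symmetrize H v u)"
    | "inj_count Q H = inj_count Q (symmetrize H u v)" "inj_count Q H = inj_count Q (symmetrize H v u)"
    unfolding symmetrization_increasing_def by (metis max_def)
  then show ?thesis
  proof cases
    case 3
    show ?thesis
    proof (cases "card (equiv_class H u) \<le> card (equiv_class H v)")
      case True
      then show ?thesis
        using that[OF uv(1)] card_equiv_pairs_symmetrize[OF fin uv] 3 by simp
    next
      case False
      then show ?thesis
        using that[OF vu] card_equiv_pairs_symmetrize[OF fin vu nvu] 3 by simp
    qed
  qed (use that[OF uv(1)] that[OF vu] in auto)
qed

lemma inj_count_le:
  assumes "finite (verts Q)" "finite (verts H)"
  shows "inj_count Q H \<le> card (verts H) ^ card (verts Q)"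
proof -
  have "card (inj_homs Q H) \<le> card (verts Q \<rightarrow>\<^sub>E verts H)"
    using assms by (intro card_mono finite_PiE inj_homs_subset)
  then show ?thesis using assms by (simp add: inj_count_def card_PiE)
qed

text \<open>The case \<open>step\<close> hides the cloned vertex and keeps what later arguments use:
  the graphs agree off \<open>u\<close>, and the count does not drop. The property travels
  backwards, from the symmetrization to the graph.\<close>

lemma symmetrization_induct [consumes 5, case_names symmetrized step]:
  assumes H: "rgraph r H" "free \<F> H"
    and Q: "rgraph r Q" and inc: "symmetrization_increasing r Q" and inv: "blowup_invariant r \<F>"
    and base: "\<And>H. rgraph r H \<Longrightarrow> free \<F> H \<Longrightarrow> symmetrized H \<Longrightarrow> P H"
    and step: "\<And>H H' u. rgraph r H \<Longrightarrow> free \<F> H \<Longrightarrow> rgraph r H' \<Longrightarrow> free \<F> H' \<Longrightarrow>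
      verts H' = verts H \<Longrightarrow> (\<And>S. u \<notin> S \<Longrightarrow> induced H' S = induced H S) \<Longrightarrow>
      inj_count Q H \<le> inj_count Q H' \<Longrightarrow> P H' \<Longrightarrow> P H"
  shows "P H"
proof -
  \<comment> \<open>Both potentials are bounded in terms of the number of vertices; their distances
    to these bounds are natural numbers that decrease lexicographically.\<close>
  define R where "R = inv_image (less_than <*lex*> less_than) (\<lambda>H.
    (card (verts H) ^ card (verts Q) - inj_count Q H, (card (verts H))\<^sup>2 - card (equiv_pairs H)))"
  have "wf R" unfolding R_def by (intro wf_inv_image wf_lex_prod wf_less_than)
  then show ?thesis using H
  proof (induction H rule: wf_induct_rule)
    case (less H)
    show ?case
    proof (cases "symmetrized H")
      case True
      then show ?thesis using base less by blast
    next
      case False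
      then obtain u v where uv: "uncovered H u v" and le: "inj_count Q H \<le> inj_count Q (symmetrize H u v)"
        and lt: "inj_count Q H < inj_count Q (symmetrize H u v) \<or>
          card (equiv_pairs H) < card (equiv_pairs (symmetrize H u v))"
        using symmetrization_step[OF less(2) _ inc] by blast
      let ?H = "symmetrize H u v"
      have H': "rgraph r ?H" "free \<F> ?H"
        using rgraph_symmetrize free_symmetrize less uv inv by blast+
      have fin: "finite (verts H)" "finite (verts Q)" using less Q by (auto simp: rgraph_def)
      have b1: "inj_count Q ?H \<le> card (verts H) ^ card (verts Q)"
        using inj_count_le[of Q ?H] fin by simp
      have "card (equiv_pairs ?H) \<le> card (verts H \<times> verts H)"
        using fin by (intro card_mono) (auto simp: equiv_pairs_def)
      then have b2: "card (equiv_pairs ?H) \<le> (card (verts H))\<^sup>2"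
        by (simp add: power2_eq_square card_cartesian_product)
      have "(?H, H) \<in> R" using le lt b1 b2 by (auto simp: R_def)
      then have "P ?H" using less(1) H' by blast
      then show ?thesis
        by (intro step[OF less(2,3) H' _ induced_symmetrize le]) auto
    qed
  qed
qed

section \<open>Degrees and densities\<close>

text \<open>Sorting maps by image makes \<open>H\<close> a weighted system of sets of size
  \<open>card (verts Q)\<close>. Counts and degrees become sums of one fixed weight over subsets, to
  which the averaging lemmas apply.\<close>

definition image_mult :: "hypergraph \<Rightarrow> hypergraph \<Rightarrow> nat set \<Rightarrow> real" where
  "image_mult Q H A = real (card {\<phi>\<in>inj_homs Q H. \<phi> ` verts Q = A})"

lemma image_mult_nonneg: "0 \<le> image_mult Q H A"
  by (simp add: image_mult_def)

lemma image_mult_le: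
  assumes Q: "finite (verts Q)"
  shows "image_mult Q H A \<le> real (card (verts Q) ^ card (verts Q))"
proof (cases "card A = card (verts Q) \<and> finite A")
  case True
  have "{\<phi>\<in>inj_homs Q H. \<phi> ` verts Q = A} \<subseteq> (verts Q \<rightarrow>\<^sub>E A)"
    by (auto simp: inj_homs_def PiE_def)
  then have "card {\<phi>\<in>inj_homs Q H. \<phi> ` verts Q = A} \<le> card (verts Q \<rightarrow>\<^sub>E A)"
    using True Q by (intro card_mono finite_PiE) auto
  then show ?thesis using True Q unfolding image_mult_def by (simp add: card_PiE flip: of_nat_power)
next
  case False
  have "finite A \<and> card A = card (verts Q)" if "\<phi> \<in> inj_homs Q H" "\<phi> ` verts Q = A" for \<phi>
    using that Q card_image[of \<phi> "verts Q"] by (auto simp: inj_homs_def)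
  with False have "{\<phi>\<in>inj_homs Q H. \<phi> ` verts Q = A} = {}" by blast
  then show ?thesis by (simp only: image_mult_def) simp
qed

lemma inj_homs_induced:
  assumes Q: "rgraph r Q" and S: "S \<subseteq> verts H"
  shows "inj_homs Q (induced H S) = {\<phi>\<in>inj_homs Q H. \<phi> ` verts Q \<subseteq> S}"
proof -
  have "hom Q (induced H S) \<phi> \<longleftrightarrow> hom Q H \<phi> \<and> \<phi> ` verts Q \<subseteq> S" for \<phi>
  proof
    assume "hom Q (induced H S) \<phi>"
    then show "hom Q H \<phi> \<and> \<phi> ` verts Q \<subseteq> S" using S by (auto simp: hom_def)
  next
    assume *: "hom Q H \<phi> \<and> \<phi> ` verts Q \<subseteq> S"
    have "\<phi> ` e \<subseteq> S" if "e \<in> edges Q" for e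
      using * that Q unfolding rgraph_def by blast
    with * show "hom Q (induced H S) \<phi>" by (auto simp: hom_def)
  qed
  then show ?thesis by (auto simp: inj_homs_def)
qed

lemma image_mult_induced:
  assumes "rgraph r Q" "S \<subseteq> verts H" "A \<subseteq> S"
  shows "image_mult Q (induced H S) A = image_mult Q H A"
  unfolding image_mult_def inj_homs_induced[OF assms(1,2)]
  using assms(3) by (intro arg_cong[where f = real] arg_cong[where f = card]) auto

text \<open>\<open>P\<close> has two uses: constantly true for \<open>inj_count\<close>, and
  containing \<open>v\<close> for \<open>degree\<close>.\<close>

lemma card_inj_homs_eq_sum:
  assumes Q: "rgraph r Q" and H: "rgraph r H" and S: "S \<subseteq> verts H"
  shows "real (card {\<phi>\<in>inj_homs Q (induced H S). P (\<phi> ` verts Q)}) =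
    (\<Sum>A\<in>{A\<in>ksub S (card (verts Q)). P A}. image_mult Q H A)"
proof -
  let ?X = "{\<phi>\<in>inj_homs Q (induced H S). P (\<phi> ` verts Q)}"
  have fin: "finite (verts Q)" "finite (verts H)" "finite S"
    using Q H S by (auto simp: rgraph_def intro: finite_subset)
  have "finite (inj_homs Q (induced H S))" using fin by (intro finite_inj_homs) auto
  then have finX: "finite ?X" by simp
  have "(\<Sum>A\<in>{A\<in>ksub S (card (verts Q)). P A}. \<Sum>\<phi>\<in>{\<phi>\<in>?X. \<phi> ` verts Q = A}. 1::real) = (\<Sum>\<phi>\<in>?X. 1)"
  proof (rule sum.group[OF finX])
    show "finite {A\<in>ksub S (card (verts Q)). P A}" using fin by simp
    show "(\<lambda>\<phi>. \<phi> ` verts Q) ` ?X \<subseteq> {A\<in>ksub S (card (verts Q)). P A}"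
      by (auto simp: inj_homs_induced[OF Q S] ksub_def) (auto simp: inj_homs_def card_image)
  qed
  moreover have "(\<Sum>\<phi>\<in>{\<phi>\<in>?X. \<phi> ` verts Q = A}. 1::real) = image_mult Q H A"
    if "A \<in> {A\<in>ksub S (card (verts Q)). P A}" for A
  proof -
    have "{\<phi>\<in>?X. \<phi> ` verts Q = A} = {\<phi>\<in>inj_homs Q H. \<phi> ` verts Q = A}"
      using that by (auto simp: inj_homs_induced[OF Q S] ksub_def)
    then show ?thesis by (simp add: image_mult_def)
  qed
  ultimately show ?thesis by simp
qed

lemma inj_count_induced:
  assumes Q: "rgraph r Q" and H: "rgraph r H" and S: "S \<subseteq> verts H"
  shows "real (inj_count Q (induced H S)) =
    real (card S choose card (verts Q)) * avg (image_mult Q H) (card (verts Q)) S"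
proof -
  have fin: "finite S" using H S by (auto simp: rgraph_def intro: finite_subset)
  have eq: "real (inj_count Q (induced H S)) = (\<Sum>A\<in>ksub S (card (verts Q)). image_mult Q H A)"
    using card_inj_homs_eq_sum[OF assms, of "\<lambda>_. True"] by (simp add: inj_count_def)
  show ?thesis
  proof (cases "card S choose card (verts Q) = 0")
    case True
    then have "ksub S (card (verts Q)) = {}" using fin card_ksub[OF fin] by (metis card_0_eq finite_ksub)
    then show ?thesis using True eq by simp
  qed (simp add: eq avg_def)
qed

lemma inj_count_eq_avg:
  assumes "rgraph r Q" "rgraph r H"
  shows "real (inj_count Q H) = real (card (verts H) choose card (verts Q)) * avg (image_mult Q H) (card (verts Q)) (verts H)"
  using inj_count_induced[OF assms order_refl] induced_verts[OF assms(2)] by simp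

text \<open>The degree of \<open>v\<close> in \<open>induced H S\<close> divided by
  \<open>card S - 1 choose (card (verts Q) - 1)\<close>, as \<open>degree_induced\<close> shows. As
  \<open>S\<close> varies this averages one fixed function over subsets of \<open>S - {v}\<close>,
  so the deviation bounds apply.\<close>

abbreviation deg_density :: "hypergraph \<Rightarrow> hypergraph \<Rightarrow> nat \<Rightarrow> nat set \<Rightarrow> real" where
  "deg_density Q H v S \<equiv> avg (\<lambda>B. image_mult Q H (insert v B)) (card (verts Q) - 1) (S - {v})"

lemma sum_image_mult_containing:
  assumes S: "finite S" and v: "v \<in> S" and q: "1 \<le> card (verts Q)"
  shows "(\<Sum>A\<in>{A\<in>ksub S (card (verts Q)). v \<in> A}. image_mult Q H A) =
    real (card S - 1 choose (card (verts Q) - 1)) * deg_density Q H v S"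
proof -
  have eq: "(\<Sum>A\<in>{A\<in>ksub S (card (verts Q)). v \<in> A}. image_mult Q H A) =
      (\<Sum>B\<in>ksub (S - {v}) (card (verts Q) - 1). image_mult Q H (insert v B))"
    by (rule sum_ksub_containing[OF S v q])
  have fin: "finite (S - {v})" using S by simp
  have c: "card (S - {v}) = card S - 1" using v S by simp
  show ?thesis
  proof (cases "card S - 1 choose (card (verts Q) - 1) = 0")
    case True
    then have "ksub (S - {v}) (card (verts Q) - 1) = {}"
      using c card_ksub[OF fin] by (metis card_0_eq finite_ksub fin)
    then show ?thesis using True eq by simp
  next
    case False
    then show ?thesis unfolding eq avg_def c by simp
  qed
qed

lemma degree_induced:
  assumes Q: "rgraph r Q" and H: "rgraph r H" and S: "S \<subseteq> verts H" and v: "v \<in> S"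
    and q: "1 \<le> card (verts Q)"
  shows "real (degree Q (induced H S) v) =
    real (card S - 1 choose (card (verts Q) - 1)) * deg_density Q H v S"
proof -
  have fin: "finite S" using H S by (auto simp: rgraph_def intro: finite_subset)
  show ?thesis
    unfolding degree_def card_inj_homs_eq_sum[OF Q H S]
    by (rule sum_image_mult_containing[OF fin v q])
qed

text \<open>The case distinction on \<open>card (verts Q) = 0\<close> is needed because \<open>deg_density\<close> uses
  \<open>card (verts Q) - 1\<close>; all degrees vanish in that case.\<close>

definition deg_density_ge :: "hypergraph \<Rightarrow> real \<Rightarrow> hypergraph \<Rightarrow> nat set \<Rightarrow> bool" where
  "deg_density_ge Q \<theta> H S \<longleftrightarrow> card (verts Q) = 0 \<or> (\<forall>v\<in>S. \<theta> \<le> deg_density Q H v S)"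

text \<open>Dividing by a binomial coefficient instead of a power of \<open>n\<close> makes the
  sequence nonincreasing from \<open>card (verts Q)\<close> on.\<close>

definition inj_density :: "nat \<Rightarrow> hypergraph \<Rightarrow> hypergraph set \<Rightarrow> nat \<Rightarrow> real" where
  "inj_density r Q \<F> n = real (inj_max r n Q \<F>) / real (n choose card (verts Q))"

lemma inj_density_nonneg: "0 \<le> inj_density r Q \<F> n"
  by (simp add: inj_density_def)

lemma deg_density_ge_mono: "deg_density_ge Q \<theta> H S \<Longrightarrow> \<theta>' \<le> \<theta> \<Longrightarrow> deg_density_ge Q \<theta>' H S"
  by (force simp: deg_density_ge_def)

lemma times_binomial_real:
  "0 < k \<Longrightarrow> real k * real (n choose k) = real n * real (n - 1 choose (k - 1))"
  using times_binomial_minus1_eq[of k n] by (metis of_nat_mult)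

text \<open>By \<open>times_binomial_real\<close>, the factor \<open>card (verts Q) / n\<close> in
  the degree threshold is exactly what turns the normalisation of counts into that of
  degrees.\<close>

lemma large_min_degree_iff_deg_density:
  assumes Q: "rgraph r Q" and H: "rgraph r H" and S: "S \<subseteq> verts H" "S \<noteq> {}"
    and q: "card (verts Q) \<le> card S"
  shows "large_min_degree r Q \<F> \<epsilon> (induced H S) \<longleftrightarrow> deg_density_ge Q ((1 - \<epsilon>) * inj_density r Q \<F> (card S)) H S"
proof (cases "card (verts Q) = 0")
  case True
  then show ?thesis by (simp add: large_min_degree_def deg_density_ge_def)
next
  case False
  define n where "n = card S"
  define k where "k = card (verts Q)"
  define C where "C = real (n - 1 choose (k - 1))"
  have fin: "finite S" using H S by (auto simp: rgraph_def intro: finite_subset)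
  have k: "1 \<le> k" "k \<le> n" using False q by (auto simp: k_def n_def)
  have C: "C > 0" using k by (simp add: C_def)
  have eq: "real k * real (inj_max r n Q \<F>) / real n = inj_density r Q \<F> n * C"
  proof -
    have "real k * real (n choose k) = real n * C" unfolding C_def using k by (intro times_binomial_real) auto
    moreover have "real (n choose k) > 0" using k by simp
    ultimately show ?thesis using k by (simp add: inj_density_def k_def field_simps)
  qed
  have ex: "\<exists>v\<in>S. min_degree Q (induced H S) = degree Q (induced H S) v"
  proof -
    have "Min (degree Q (induced H S) ` S) \<in> degree Q (induced H S) ` S"
      using fin S(2) by (intro Min_in) auto
    then show ?thesis unfolding min_degree_def verts_induced by blast
  qed
  have le: "min_degree Q (induced H S) \<le> degree Q (induced H S) v" if "v \<in> S" for v
    using that fin by (auto simp: min_degree_def)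
  have "x \<le> real (min_degree Q (induced H S)) \<longleftrightarrow> (\<forall>v\<in>S. x \<le> real (degree Q (induced H S) v))" for x
    using ex le by (metis of_nat_le_iff order_trans)
  then have "large_min_degree r Q \<F> \<epsilon> (induced H S) \<longleftrightarrow>
      (\<forall>v\<in>S. (1 - \<epsilon>) * (inj_density r Q \<F> n * C) \<le> real (degree Q (induced H S) v))"
    unfolding large_min_degree_def Let_def verts_induced using eq by (simp add: k_def n_def)
  also have "\<dots> \<longleftrightarrow> (\<forall>v\<in>S. C * ((1 - \<epsilon>) * inj_density r Q \<F> n) \<le> C * deg_density Q H v S)"
    using degree_induced[OF Q H S(1)] k
    by (intro ball_cong refl) (simp add: C_def k_def n_def ac_simps)
  also have "\<dots> \<longleftrightarrow> deg_density_ge Q ((1 - \<epsilon>) * inj_density r Q \<F> (card S)) H S"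
    using C False by (simp add: deg_density_ge_def n_def)
  finally show ?thesis .
qed

text \<open>Double counting: each set is counted once per vertex, so the mean of the degree
  densities is the density of maps.\<close>

lemma deg_density_ge_imp_avg:
  assumes S: "finite S" and q: "1 \<le> card (verts Q)" "card (verts Q) \<le> card S" and good: "deg_density_ge Q \<theta> H S"
  shows "\<theta> \<le> avg (image_mult Q H) (card (verts Q)) S"
proof -
  define n where "n = card S"
  define k where "k = card (verts Q)"
  define C where "C = real (n - 1 choose (k - 1))"
  have pos: "C > 0" "n > 0" "k > 0" "real (n choose k) > 0" using q by (auto simp: C_def n_def k_def)
  have "real n * (C * \<theta>) = (\<Sum>v\<in>S. C * \<theta>)" by (simp add: n_def)
  also have "\<dots> \<le> (\<Sum>v\<in>S. C * deg_density Q H v S)"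
    using good q pos by (intro sum_mono mult_left_mono) (auto simp: deg_density_ge_def)
  also have "\<dots> = (\<Sum>v\<in>S. \<Sum>A\<in>{A\<in>ksub S k. v \<in> A}. image_mult Q H A)"
    using sum_image_mult_containing[OF S _ q(1)] by (intro sum.cong refl) (simp add: C_def n_def k_def)
  also have "\<dots> = (\<Sum>A\<in>ksub S k. \<Sum>v\<in>{v\<in>S. v \<in> A}. image_mult Q H A)"
    by (rule sum.swap_restrict) (use S in auto)
  also have "\<dots> = (\<Sum>A\<in>ksub S k. real k * image_mult Q H A)"
  proof (intro sum.cong refl)
    fix A assume "A \<in> ksub S k"
    then have "{v\<in>S. v \<in> A} = A" "card A = k" by (auto simp: ksub_def)
    then show "(\<Sum>v\<in>{v\<in>S. v \<in> A}. image_mult Q H A) = real k * image_mult Q H A" by simp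
  qed
  also have "\<dots> = real k * real (n choose k) * avg (image_mult Q H) k S"
    using pos by (simp add: avg_def n_def flip: sum_distrib_left)
  also have "\<dots> = real n * C * avg (image_mult Q H) k S"
    using times_binomial_real[of k n] pos by (simp add: C_def)
  finally show ?thesis using pos by (simp add: k_def mult.assoc)
qed

section \<open>Extremal densities and their limit\<close>

lemma inj_count_le_max:
  assumes "rgraph r Q" "rgraph r H" "free \<F> H"
  shows "inj_count Q H \<le> inj_max r (card (verts H)) Q \<F>"
  unfolding inj_max_def using assms finite_free_inj_counts[OF assms(1)]
  by (intro Max_ge) (auto simp: free_inj_counts_def)

lemma inj_max_cases:
  assumes "rgraph r Q"
  obtains "inj_max r n Q \<F> = 0"
  | H where "rgraph r H" "card (verts H) = n" "free \<F> H" "inj_count Q H = inj_max r n Q \<F>"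
proof -
  have "inj_max r n Q \<F> \<in> insert 0 (free_inj_counts r n Q \<F>)"
    unfolding inj_max_def using finite_free_inj_counts[OF assms] by (intro Max_in) auto
  then show ?thesis using that unfolding free_inj_counts_def by auto
qed

lemma avg_image_mult_le_density:
  assumes Q: "rgraph r Q" and H: "rgraph r H" "free \<F> H" and S: "S \<subseteq> verts H"
  shows "avg (image_mult Q H) (card (verts Q)) S \<le> inj_density r Q \<F> (card S)"
proof (cases "card S choose card (verts Q) = 0")
  case True
  then show ?thesis by (simp only: avg_def inj_density_def) simp
next
  case False
  have "real (inj_count Q (induced H S)) \<le> real (inj_max r (card S) Q \<F>)"
    using inj_count_le_max[OF Q rgraph_induced[OF H(1) S] free_mono[OF subgraph_induced[OF S] H(2)]] by simp
  then show ?thesis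
    unfolding inj_count_induced[OF Q H(1) S] inj_density_def
    using False by (simp only: pos_le_divide_eq of_nat_0_less_iff neq0_conv mult.commute)
qed

text \<open>The averaging of Katona, Nemetz and Simonovits: all \<open>n\<close>-subsets of an
  extremal graph on \<open>Suc n\<close> vertices span free graphs.\<close>

lemma inj_density_Suc_le:
  assumes Q: "rgraph r Q" and n: "card (verts Q) \<le> n"
  shows "inj_density r Q \<F> (Suc n) \<le> inj_density r Q \<F> n"
proof (cases rule: inj_max_cases[OF Q, of "Suc n" \<F>])
  case 1
  then show ?thesis by (simp add: inj_density_def)
next
  case (2 H)
  have fin: "finite (verts H)" using 2 by (simp add: rgraph_def)
  have "inj_density r Q \<F> (Suc n) = avg (image_mult Q H) (card (verts Q)) (verts H)"
    using inj_count_eq_avg[OF Q 2(1)] 2 n by (simp add: inj_density_def field_simps)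
  also have "\<dots> = avg (avg (image_mult Q H) (card (verts Q))) n (verts H)"
    using avg_tower[OF fin n] 2 by simp
  also have "\<dots> \<le> inj_density r Q \<F> n"
    using avg_image_mult_le_density[OF Q 2(1,3)]
    by (intro avg_le[OF fin inj_density_nonneg]) blast
  finally show ?thesis .
qed

lemma binomial_over_power_tendsto:
  "(\<lambda>n. real (n choose k) / real n ^ k) \<longlonglongrightarrow> 1 / fact k"
proof (induction k)
  case 0
  then show ?case by simp
next
  case (Suc k)
  have "(\<lambda>n. 1 - real k / real n) \<longlonglongrightarrow> 1 - 0"
    by (intro tendsto_diff tendsto_const lim_const_over_n)
  then have "(\<lambda>n. real (n choose k) / real n ^ k * (1 - real k / real n) / real (Suc k)) \<longlonglongrightarrow> 1 / fact k * (1 - 0) / real (Suc k)"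
    by (intro tendsto_mult tendsto_divide Suc tendsto_const) auto
  moreover have "1 / fact k * (1 - 0) / real (Suc k) = 1 / fact (Suc k)" by (simp add: field_simps)
  ultimately have "(\<lambda>n. real (n choose k) / real n ^ k * (1 - real k / real n) / real (Suc k)) \<longlonglongrightarrow> 1 / fact (Suc k)"
    by (simp only:)
  moreover have "\<forall>\<^sub>F n in sequentially. real (n choose k) / real n ^ k * (1 - real k / real n) / real (Suc k) = real (n choose Suc k) / real n ^ Suc k"
    using eventually_gt_at_top[of k]
  proof eventually_elim
    case (elim n)
    have "real (Suc k * (n choose Suc k)) = real ((n - k) * (n choose k))"
      unfolding binomial_absorb_comp binomial_absorption ..
    then have "real (n choose Suc k) = (real n - real k) * real (n choose k) / real (Suc k)"
      unfolding of_nat_mult using elim by (simp add: field_simps of_nat_diff)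
    moreover have "b / p * (1 - c / x) / d = (x - c) * b / d / (x * p)" if "x > 0" "p > 0" "d > 0"
      for b c d p x :: real
      using that by (simp add: field_simps)
    ultimately show ?case using elim by simp
  qed
  ultimately show ?case by (rule Lim_transform_eventually)
qed

text \<open>\<open>pi_inj\<close> is a bare \<open>lim\<close>, so convergence has to be derived,
  here from monotonicity, which also puts the terms above \<open>L\<close>. The limit
  \<open>L\<close> is \<open>pi_inj r Q \<F>\<close> times
  \<open>fact (card (verts Q))\<close>.\<close>

lemma inj_density_limit:
  assumes Q: "rgraph r Q" and pos: "pi_inj r Q \<F> > 0"
  obtains L where "L > 0" "inj_density r Q \<F> \<longlonglongrightarrow> L"
    "\<And>n. card (verts Q) \<le> n \<Longrightarrow> L \<le> inj_density r Q \<F> n"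
proof -
  define k where "k = card (verts Q)"
  define X where "X n = inj_density r Q \<F> (n + k)" for n
  have dec: "decseq X"
    unfolding X_def using inj_density_Suc_le[OF Q] by (intro decseq_SucI) (simp add: k_def)
  obtain L where L: "X \<longlonglongrightarrow> L"
    by (rule decseq_convergent[OF dec, of 0]) (auto simp: X_def inj_density_nonneg)
  have lim: "inj_density r Q \<F> \<longlonglongrightarrow> L"
    using L unfolding X_def by (rule LIMSEQ_offset)
  have "(\<lambda>n. inj_density r Q \<F> n * (real (n choose k) / real n ^ k)) \<longlonglongrightarrow> L * (1 / fact k)"
    by (intro tendsto_mult lim binomial_over_power_tendsto)
  moreover have "\<forall>\<^sub>F n in sequentially. inj_density r Q \<F> n * (real (n choose k) / real n ^ k) = real (inj_max r n Q \<F>) / real n ^ k"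
    using eventually_ge_at_top[of k] by eventually_elim (simp add: inj_density_def k_def)
  ultimately have "(\<lambda>n. real (inj_max r n Q \<F>) / real n ^ k) \<longlonglongrightarrow> L * (1 / fact k)"
    by (rule Lim_transform_eventually)
  then have "pi_inj r Q \<F> = L / fact k" unfolding pi_inj_def k_def by (simp add: limI)
  then have "L > 0" using pos by (simp add: zero_less_divide_iff)
  moreover have "L \<le> inj_density r Q \<F> n" if "k \<le> n" for n
    using decseq_ge[OF dec L, of "n - k"] that by (simp add: X_def)
  ultimately show ?thesis using that lim by (simp add: k_def)
qed

text \<open>This lets the limit \<open>L\<close> for \<open>\<F>\<close> bound the densities for
  \<open>\<F>'\<close> from above.\<close>

lemma inj_max_le_if_symmetrized_stable:
  assumes Q: "rgraph r Q" and \<HH>: "\<forall>H\<in>\<HH>. free \<F> H"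
    and inc: "symmetrization_increasing r Q" and inv: "blowup_invariant r \<F>'"
    and st: "symmetrized_stable r \<F>' \<HH>"
  shows "inj_max r n Q \<F>' \<le> inj_max r n Q \<F>"
proof (cases rule: inj_max_cases[OF Q, of n \<F>'])
  case 1
  then show ?thesis by simp
next
  case (2 H)
  have "inj_count Q H \<le> inj_max r (card (verts H)) Q \<F>"
    using 2(1,3) Q inc inv
  proof (induction rule: symmetrization_induct)
    case (symmetrized H)
    then show ?case using st \<HH> inj_count_le_max[OF Q] by (auto simp: symmetrized_stable_def)
  qed simp
  then show ?thesis using 2 by simp
qed

section \<open>Stability of the blowup-invariant family\<close>

lemma power_one_minus_le:
  fixes a :: real
  assumes "0 \<le> a" "a \<le> 1"
  shows "(1 - a) ^ q \<le> 1 - real q * a + (real q)\<^sup>2 * a\<^sup>2"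
proof (induction q)
  case 0
  then show ?case by simp
next
  case (Suc q)
  have "(1 - a) ^ Suc q \<le> (1 - a) * (1 - real q * a + (real q)\<^sup>2 * a\<^sup>2)"
    using Suc assms by (simp add: mult_left_mono)
  also have "\<dots> = 1 - real (Suc q) * a + (real (Suc q))\<^sup>2 * a\<^sup>2 - (real q + 1) * a\<^sup>2 - (real q)\<^sup>2 * a ^ 3"
    by (simp add: algebra_simps power2_eq_square power3_eq_cube)
  also have "\<dots> \<le> 1 - real (Suc q) * a + (real (Suc q))\<^sup>2 * a\<^sup>2"
  proof -
    have "0 \<le> (real q + 1) * a\<^sup>2" "0 \<le> (real q)\<^sup>2 * a ^ 3" using assms by auto
    then show ?thesis by linarith
  qed
  finally show ?case .
qed

text \<open>Factor by factor: \<open>n - z - i \<le> (n - i) * (1 - z / n)\<close>.\<close>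

lemma binomial_shrink_le:
  assumes z: "z \<le> n" and n: "0 < n"
  shows "real ((n - z) choose q) \<le> real (n choose q) * (1 - real z / real n) ^ q"
proof (induction q)
  case 0
  then show ?case by simp
next
  case (Suc q)
  let ?b = "1 - real z / real n"
  have b: "0 \<le> ?b" using z n by simp
  have rec: "real (Suc q) * real (m choose Suc q) = real (m - q) * real (m choose q)" for m
  proof -
    have "Suc q * (m choose Suc q) = (m - q) * (m choose q)"
      unfolding binomial_absorb_comp binomial_absorption ..
    then show ?thesis by (metis of_nat_mult)
  qed
  have le: "real (n - z - q) \<le> real (n - q) * ?b"
  proof (cases "n - z \<le> q")
    case True
    then show ?thesis using b by simp
  next
    case False
    have "real (n - z - q) = real n - real z - real q" using False by simp
    also have "\<dots> \<le> (real n - real q) * ?b" using n by (simp add: field_simps)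
    finally show ?thesis using False by simp
  qed
  have "real (Suc q) * real ((n - z) choose Suc q) = real (n - z - q) * real ((n - z) choose q)"
    by (rule rec)
  also have "\<dots> \<le> (real (n - q) * ?b) * (real (n choose q) * ?b ^ q)"
    using Suc le b by (intro mult_mono) auto
  also have "\<dots> = (real (n - q) * real (n choose q)) * ?b ^ Suc q" by simp
  also have "\<dots> = real (Suc q) * (real (n choose Suc q) * ?b ^ Suc q)"
    unfolding rec[symmetric] by simp
  finally show ?case by (simp only: mult_le_cancel_left_pos[of "real (Suc q)"] of_nat_0_less_iff zero_less_Suc)
qed

text \<open>The conjunct on \<open>card (verts Q)\<close> empties the set when \<open>Q\<close> has
  no vertices, where \<open>deg_density\<close> does not describe degrees.\<close>

definition low_degree :: "hypergraph \<Rightarrow> real \<Rightarrow> hypergraph \<Rightarrow> nat set" where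
  "low_degree Q \<theta> H = {v\<in>verts H. 1 \<le> card (verts Q) \<and> deg_density Q H v (verts H) < \<theta>}"

text \<open>Deleting \<open>a n\<close> low-degree vertices loses at most \<open>a q (1 - \<kappa>) L (n choose q)\<close> maps, while
  the maximum drops by about \<open>a q L (n choose q)\<close>.\<close>

lemma card_low_degree_le:
  assumes Q: "rgraph r Q" and H: "rgraph r H" "free \<F> H" and L: "0 < L"
    and dens: "\<And>k. K \<le> k \<Longrightarrow> inj_density r Q \<F> k \<le> (1 + \<eta>) * L"
    and many: "(1 - e) * L \<le> avg (image_mult Q H) (card (verts Q)) (verts H)"
    and \<zeta>: "0 < \<zeta>" "\<zeta> \<le> 1 / 4" "4 * real (card (verts Q)) * \<zeta> \<le> \<kappa>"
    and e: "0 \<le> \<eta>" "e + \<eta> < \<zeta> * \<kappa> / 2"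
    and n: "2 * K \<le> card (verts H)" "1 \<le> \<zeta> * real (card (verts H))" "card (verts Q) \<le> card (verts H)"
  shows "real (card (low_degree Q ((1 - \<kappa>) * L) H)) \<le> \<zeta> * real (card (verts H))"
proof (rule ccontr)
  assume "\<not> ?thesis"
  then have big: "\<zeta> * real (card (verts H)) < real (card (low_degree Q ((1 - \<kappa>) * L) H))" by simp
  define q where "q = card (verts Q)"
  define N where "N = card (verts H)"
  define V where "V = verts H"
  define \<theta> where "\<theta> = (1 - \<kappa>) * L"
  have finV: "finite V" using H by (simp add: rgraph_def V_def)
  have q1: "1 \<le> q"
  proof (rule ccontr)
    assume "\<not> 1 \<le> q"
    then have "low_degree Q ((1 - \<kappa>) * L) H = {}" by (simp add: low_degree_def q_def)
    moreover have "0 \<le> \<zeta> * real (card (verts H))" using \<zeta>(1) by simp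
    ultimately show False using big by simp
  qed
  have Npos: "0 < N" using n \<zeta> by (intro Nat.gr0I) (simp add: N_def)
  \<comment> \<open>Only about \<open>\<zeta> * N\<close> low-degree vertices are deleted, even if
    there are more: \<open>q * a\<close> stays small, and at least \<open>K\<close> vertices
    remain.\<close>
  define z where "z = nat \<lceil>\<zeta> * real N\<rceil>"
  have z: "\<zeta> * real N \<le> real z" "real z \<le> 2 * (\<zeta> * real N)"
    using n \<zeta> unfolding z_def N_def by linarith+
  have "z \<le> card (low_degree Q \<theta> H)" using big unfolding z_def N_def \<theta>_def by linarith
  then obtain Z where Z: "Z \<subseteq> low_degree Q \<theta> H" "card Z = z" using obtain_subset_with_card_n by blast
  have ZV: "Z \<subseteq> V" using Z by (auto simp: low_degree_def V_def)
  then have finZ: "finite Z" using finV finite_subset by blast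
  have zN: "z \<le> N" using card_mono[OF finV ZV] Z by (simp add: N_def V_def)
  define a where "a = real z / real N"
  have a: "\<zeta> \<le> a" "a \<le> 2 * \<zeta>" using z Npos by (auto simp: a_def field_simps)
  define B where "B = real (N choose q)"
  have B: "B > 0" using n by (simp add: B_def q_def N_def)
  define C where "C = real (N - 1 choose (q - 1))"
  have BC: "real q * B = real N * C" unfolding B_def C_def using q1 by (intro times_binomial_real) auto
  have cVZ: "card (V - Z) = N - z" using ZV Z finZ by (simp add: card_Diff_subset N_def V_def)
  have avgV: "B * avg (image_mult Q H) q V = (\<Sum>A\<in>ksub V q. image_mult Q H A)"
    using B by (simp add: avg_def B_def N_def V_def)
  \<comment> \<open>A set meeting \<open>Z\<close> is charged to each of its vertices in
    \<open>Z\<close>; overcounting is harmless in an upper bound.\<close>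
  have "(\<Sum>A\<in>ksub V q. image_mult Q H A) \<le>
      (\<Sum>A\<in>ksub V q. (if A \<subseteq> V - Z then image_mult Q H A else 0) + (\<Sum>v\<in>Z. if v \<in> A then image_mult Q H A else 0))"
  proof (rule sum_mono)
    fix A assume A: "A \<in> ksub V q"
    have nn: "0 \<le> (\<Sum>v\<in>Z. if v \<in> A then image_mult Q H A else 0)" by (intro sum_nonneg) (auto simp: image_mult_nonneg)
    show "image_mult Q H A \<le> (if A \<subseteq> V - Z then image_mult Q H A else 0) + (\<Sum>v\<in>Z. if v \<in> A then image_mult Q H A else 0)"
    proof (cases "A \<subseteq> V - Z")
      case False
      then obtain v where v: "v \<in> Z" "v \<in> A" using A by (auto simp: ksub_def)
      have "(if v \<in> A then image_mult Q H A else 0) \<le> (\<Sum>v\<in>Z. if v \<in> A then image_mult Q H A else 0)"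
        using v(1) finZ by (intro member_le_sum) (auto simp: image_mult_nonneg)
      then show ?thesis using False v by simp
    qed (use nn in simp)
  qed
  also have "\<dots> = (\<Sum>A\<in>ksub (V - Z) q. image_mult Q H A) + (\<Sum>v\<in>Z. \<Sum>A\<in>{A\<in>ksub V q. v \<in> A}. image_mult Q H A)"
  proof -
    have "{A\<in>ksub V q. A \<subseteq> V - Z} = ksub (V - Z) q" by (auto simp: ksub_def)
    moreover have "(\<Sum>A\<in>ksub V q. \<Sum>v\<in>Z. if v \<in> A then image_mult Q H A else 0) = (\<Sum>v\<in>Z. \<Sum>A\<in>ksub V q. if v \<in> A then image_mult Q H A else 0)"
      by (rule sum.swap)
    ultimately show ?thesis using finV by (simp add: sum.distrib flip: sum.inter_filter)
  qed
  also have "(\<Sum>v\<in>Z. \<Sum>A\<in>{A\<in>ksub V q. v \<in> A}. image_mult Q H A) \<le> (\<Sum>v\<in>Z. C * \<theta>)"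
  proof (rule sum_mono)
    fix v assume v: "v \<in> Z"
    have "(\<Sum>A\<in>{A\<in>ksub V q. v \<in> A}. image_mult Q H A) = C * deg_density Q H v V"
      using sum_image_mult_containing[OF finV _ q1[unfolded q_def]] v ZV by (auto simp: q_def C_def N_def V_def)
    also have "\<dots> \<le> C * \<theta>" using v Z by (intro mult_left_mono) (auto simp: low_degree_def V_def C_def)
    finally show "(\<Sum>A\<in>{A\<in>ksub V q. v \<in> A}. image_mult Q H A) \<le> C * \<theta>" .
  qed
  also have "(\<Sum>v\<in>Z. C * \<theta>) = B * (real q * a * \<theta>)"
  proof -
    have "real z * C = a * (real N * C)" using Npos by (simp add: a_def)
    then show ?thesis using Z by (simp add: BC[symmetric])
  qed
  also have "(\<Sum>A\<in>ksub (V - Z) q. image_mult Q H A) \<le> B * ((1 + \<eta>) * L * (1 - a) ^ q)"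
  proof -
    have "K \<le> card (V - Z)"
    proof -
      have "real z \<le> real N / 2" using z \<zeta>(1,2) mult_right_mono[of \<zeta> "1/4" "real N"] by simp
      then show ?thesis using n cVZ zN unfolding N_def by linarith
    qed
    then have "avg (image_mult Q H) q (V - Z) \<le> (1 + \<eta>) * L"
      using avg_image_mult_le_density[OF Q H, of "V - Z"] dens[of "card (V - Z)"] by (auto simp: q_def V_def)
    moreover have "(\<Sum>A\<in>ksub (V - Z) q. image_mult Q H A) = real (N - z choose q) * avg (image_mult Q H) q (V - Z)"
    proof (cases "N - z choose q = 0")
      case True
      then have "ksub (V - Z) q = {}" using cVZ finV card_ksub[of "V - Z" q]
        by (metis card_0_eq finite_Diff finite_ksub)
      then show ?thesis using True by simp
    next
      case False
      then show ?thesis unfolding avg_def cVZ by simp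
    qed
    moreover have "real (N - z choose q) * avg (image_mult Q H) q (V - Z) \<le> (B * (1 - a) ^ q) * ((1 + \<eta>) * L)"
    proof (rule mult_mono)
      show "real (N - z choose q) \<le> B * (1 - a) ^ q"
        unfolding B_def a_def by (rule binomial_shrink_le[OF zN Npos])
      show "0 \<le> B * (1 - a) ^ q" using B a \<zeta> by simp
      show "0 \<le> avg (image_mult Q H) q (V - Z)" by (intro avg_nonneg image_mult_nonneg)
    qed fact
    ultimately show ?thesis by (simp add: ac_simps)
  qed
  finally have "B * avg (image_mult Q H) q V \<le> B * ((1 + \<eta>) * L * (1 - a) ^ q + real q * a * \<theta>)"
    unfolding avgV by (simp add: algebra_simps)
  then have "avg (image_mult Q H) q V \<le> (1 + \<eta>) * L * (1 - a) ^ q + real q * a * \<theta>" using B by simp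
  then have "(1 - e) * L \<le> ((1 + \<eta>) * (1 - a) ^ q + real q * a * (1 - \<kappa>)) * L"
    using many unfolding q_def V_def \<theta>_def by (simp add: algebra_simps)
  then have "1 - e \<le> (1 + \<eta>) * (1 - a) ^ q + real q * a * (1 - \<kappa>)" using L by simp
  also have "(1 + \<eta>) * (1 - a) ^ q \<le> \<eta> + (1 - a) ^ q"
  proof -
    have "(1 - a) ^ q \<le> 1" using a \<zeta> by (intro power_le_one) auto
    then have "\<eta> * (1 - a) ^ q \<le> \<eta>" using e by (simp add: mult_left_le)
    then show ?thesis by (simp add: algebra_simps)
  qed
  also have "(1 - a) ^ q \<le> 1 - real q * a + (real q)\<^sup>2 * a\<^sup>2"
    using a \<zeta> by (intro power_one_minus_le) auto
  \<comment> \<open>The surplus is \<open>q * a * \<kappa>\<close>. The bound on \<zeta> keeps the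
    quadratic error below half of it, and the other half exceeds \<open>e + \<eta>\<close>.\<close>
  finally have "real q * a * \<kappa> \<le> e + \<eta> + (real q * a) * (real q * a)"
    by (simp add: algebra_simps power2_eq_square)
  also have "(real q * a) * (real q * a) \<le> (real q * a) * (\<kappa> / 2)"
  proof (rule mult_left_mono)
    have "real q * a \<le> real q * (2 * \<zeta>)" using a by (intro mult_left_mono) auto
    then show "real q * a \<le> \<kappa> / 2" using \<zeta>(3) unfolding q_def by linarith
  qed (use a \<zeta> in auto)
  finally have "real q * a * \<kappa> / 2 \<le> e + \<eta>" by simp
  moreover have "\<zeta> * \<kappa> \<le> real q * a * \<kappa>"
  proof (rule mult_right_mono)
    show "\<zeta> \<le> real q * a" using a q1 \<zeta> mult_mono[of 1 "real q" \<zeta> a] by auto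
    show "0 \<le> \<kappa>" using \<zeta> by (meson less_imp_le mult_nonneg_nonneg of_nat_0_le_iff order_trans zero_le_numeral)
  qed
  ultimately show False using e by linarith
qed

lemma large_min_degree_mono:
  assumes "large_min_degree r Q \<F> \<epsilon> H" "\<epsilon> \<le> \<epsilon>'"
  shows "large_min_degree r Q \<F> \<epsilon>' H"
proof -
  have "(1 - \<epsilon>') * x \<le> (1 - \<epsilon>) * x" if "0 \<le> x" for x
    using assms(2) that by (intro mult_right_mono) auto
  then show ?thesis using assms(1) unfolding large_min_degree_def Let_def
    by (meson divide_nonneg_nonneg mult_nonneg_nonneg of_nat_0_le_iff order_trans)
qed

text \<open>\<open>\<epsilon> \<le> 1\<close> keeps \<open>1 - \<epsilon>\<close> nonnegative, so
  that upper bounds on densities can be multiplied by it.\<close>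

lemma vertex_extendableE:
  assumes "vertex_extendable r Q \<F> \<HH>"
  obtains \<epsilon> N0 where "0 < \<epsilon>" "\<epsilon> \<le> 1"
    "\<And>H. rgraph r H \<Longrightarrow> free \<F> H \<Longrightarrow> N0 \<le> card (verts H) \<Longrightarrow> large_min_degree r Q \<F> \<epsilon> H \<Longrightarrow>
      \<exists>v\<in>verts H. remove_vertex H v \<in> \<HH> \<Longrightarrow> H \<in> \<HH>"
proof -
  obtain \<epsilon> N0 where \<epsilon>: "0 < \<epsilon>" and ext: "\<And>H. rgraph r H \<Longrightarrow> free \<F> H \<Longrightarrow> N0 \<le> card (verts H) \<Longrightarrow>
      large_min_degree r Q \<F> \<epsilon> H \<Longrightarrow> \<exists>v\<in>verts H. remove_vertex H v \<in> \<HH> \<Longrightarrow> H \<in> \<HH>"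
    using assms unfolding vertex_extendable_def by blast
  show ?thesis
    by (rule that[of "min \<epsilon> 1" N0]) (use \<epsilon> ext large_min_degree_mono[of r Q \<F> "min \<epsilon> 1" _ \<epsilon>] in auto)
qed

lemma hereditary_induced:
  assumes "hereditary r \<HH>" "induced H S \<in> \<HH>" "rgraph r H" "T \<subseteq> S" "S \<subseteq> verts H"
  shows "induced H T \<in> \<HH>"
proof -
  have "subgraph (induced H T) (induced H S)" using assms(4) by (auto simp: subgraph_def)
  moreover have "rgraph r (induced H T)" using assms by (intro rgraph_induced) auto
  ultimately show ?thesis using assms by (auto simp: hereditary_def)
qed

text \<open>The vertices of \<open>T - W\<close> are added in an arbitrary order, hence the degree
  condition on every nonempty set between \<open>W\<close> and \<open>T\<close>.\<close>

lemma extend_induced: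
  assumes H: "rgraph r H" "free \<F> H" and T: "T \<subseteq> verts H" and W: "W \<subseteq> T" "induced H W \<in> \<HH>" "N0 \<le> card W"
    and ext: "\<And>H. rgraph r H \<Longrightarrow> free \<F> H \<Longrightarrow> N0 \<le> card (verts H) \<Longrightarrow> large_min_degree r Q \<F> \<epsilon> H \<Longrightarrow>
      \<exists>v\<in>verts H. remove_vertex H v \<in> \<HH> \<Longrightarrow> H \<in> \<HH>"
    and deg: "\<And>U. W \<subseteq> U \<Longrightarrow> U \<subseteq> T \<Longrightarrow> U \<noteq> {} \<Longrightarrow> large_min_degree r Q \<F> \<epsilon> (induced H U)"
  shows "induced H T \<in> \<HH>"
proof -
  have "finite T" using H T by (auto simp: rgraph_def intro: finite_subset)
  then have finD: "finite (T - W)" by simp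
  have "induced H (W \<union> D) \<in> \<HH>" if "finite D" "D \<subseteq> T - W" for D
    using that
  proof (induction D rule: finite_induct)
    case empty
    then show ?case using W by simp
  next
    case (insert x D)
    let ?U = "W \<union> insert x D"
    have U: "?U \<subseteq> T" "?U - {x} = W \<union> D" using insert W by auto
    have "N0 \<le> card ?U" using W(3) card_mono[of ?U W] U(1) \<open>finite T\<close> finite_subset[of ?U T]
      by (meson Un_upper1 le_trans)
    moreover have "remove_vertex (induced H ?U) x \<in> \<HH>"
      using insert U by (simp add: remove_vertex_induced)
    moreover have "rgraph r (induced H ?U)" "free \<F> (induced H ?U)"
      using rgraph_induced free_mono[OF subgraph_induced] H T U(1) by (meson order_trans)+
    moreover have "large_min_degree r Q \<F> \<epsilon> (induced H ?U)" using U by (intro deg) auto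
    ultimately show ?case by (intro ext) auto
  qed
  from this[OF finD order_refl] W(1) show ?thesis by (simp add: Un_absorb1)
qed

text \<open>The conclusion is shaped so that the induction returns it unchanged: near-extremality
  passes from \<open>H\<close> to its symmetrization, and only vertices of low degree in
  \<open>H\<close> itself stay deleted.\<close>

lemma almost_extremal_in_family:
  assumes Q: "rgraph r Q" and her: "hereditary r \<HH>"
    and inc: "symmetrization_increasing r Q" and inv: "blowup_invariant r \<F>"
    and st: "symmetrized_stable r \<F> \<HH>" and ext: "vertex_extendable r Q \<F> \<HH>"
    and L: "0 < L" and dens: "\<And>\<eta>. 0 < \<eta> \<Longrightarrow> \<exists>K. \<forall>k\<ge>K. inj_density r Q \<F> k \<le> (1 + \<eta>) * L"
  shows "\<exists>e>0. \<exists>\<kappa>>0. \<exists>N. \<forall>H. rgraph r H \<longrightarrow> free \<F> H \<longrightarrow> N \<le> card (verts H) \<longrightarrow>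
     (1 - e) * L \<le> avg (image_mult Q H) (card (verts Q)) (verts H) \<longrightarrow>
     induced H (verts H - low_degree Q ((1 - \<kappa>) * L) H) \<in> \<HH>"
proof -
  obtain \<epsilon> N0 where \<epsilon>: "0 < \<epsilon>" "\<epsilon> \<le> 1" and ext: "\<And>H. rgraph r H \<Longrightarrow> free \<F> H \<Longrightarrow> N0 \<le> card (verts H) \<Longrightarrow>
      large_min_degree r Q \<F> \<epsilon> H \<Longrightarrow> \<exists>v\<in>verts H. remove_vertex H v \<in> \<HH> \<Longrightarrow> H \<in> \<HH>"
    using vertex_extendableE[OF ext] by blast
  define q where "q = card (verts Q)"
  define M where "M = real (q ^ q)"
  define c where "c = M * real (q - 1)"
  have c: "0 \<le> c" by (simp add: c_def M_def)
  have multM: "image_mult Q H A \<le> M" for H A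
    using image_mult_le[of Q H A] Q by (simp add: M_def q_def rgraph_def)
  define \<kappa> where "\<kappa> = \<epsilon> / 4"
  have \<kappa>: "0 < \<kappa>" using \<epsilon> by (simp add: \<kappa>_def)
  \<comment> \<open>The first entry makes losing \<open>3 * \<zeta> * n\<close> vertices leave at
    least \<open>n / 2\<close>, the second is what \<open>card_low_degree_le\<close> asks for, and
    the third keeps the resulting change of a degree density below
    \<open>\<epsilon> * L / 4\<close>.\<close>
  define \<zeta> where "\<zeta> = Min {1 / 12, \<kappa> / (4 * (real q + 1)), \<epsilon> * L / (48 * (c + 1))}"
  have \<zeta>0: "0 < \<zeta>" using \<kappa> \<epsilon> L c by (simp add: \<zeta>_def)
  have \<zeta>1: "\<zeta> \<le> 1 / 12" and \<zeta>2': "\<zeta> \<le> \<kappa> / (4 * (real q + 1))" and \<zeta>3': "\<zeta> \<le> \<epsilon> * L / (48 * (c + 1))"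
    unfolding \<zeta>_def by (rule Min_le; simp)+
  have \<zeta>2: "4 * real q * \<zeta> \<le> \<kappa>"
    using \<zeta>2' \<zeta>0 by (simp add: le_divide_eq algebra_simps)
  have \<zeta>3: "12 * \<zeta> * c \<le> \<epsilon> * L / 4"
    using \<zeta>3' \<zeta>0 c by (simp add: le_divide_eq algebra_simps)
  define \<eta> where "\<eta> = min (\<epsilon> / 4) (\<zeta> * \<kappa> / 8)"
  have \<eta>: "0 < \<eta>" "\<eta> \<le> \<epsilon> / 4" "\<eta> \<le> \<zeta> * \<kappa> / 8" using \<epsilon> \<zeta>0 \<kappa> by (auto simp: \<eta>_def)
  obtain K where K: "\<And>k. K \<le> k \<Longrightarrow> inj_density r Q \<F> k \<le> (1 + \<eta>) * L" using dens[OF \<eta>(1)] by blast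
  define e where "e = \<zeta> * \<kappa> / 8"
  have e: "0 < e" using \<zeta>0 \<kappa> by (simp add: e_def)
  have e\<eta>: "e + \<eta> < \<zeta> * \<kappa> / 2" using \<eta>(3) e unfolding e_def by linarith
  define N where "N = 2 * K + nat \<lceil>1 / \<zeta>\<rceil> + 4 * q + 4 + 2 * N0"
  have small: "real (card (low_degree Q ((1 - \<kappa>) * L) H)) \<le> \<zeta> * real (card (verts H))"
    if "rgraph r H" "free \<F> H" "N \<le> card (verts H)"
      "(1 - e) * L \<le> avg (image_mult Q H) q (verts H)" for H
  proof -
    have "1 \<le> \<zeta> * real (card (verts H))"
    proof -
      have "1 / \<zeta> \<le> real (card (verts H))" using that(3) unfolding N_def by linarith
      then show ?thesis using \<zeta>0 by (simp add: field_simps)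
    qed
    then show ?thesis
      using that \<zeta>0 \<zeta>1 \<zeta>2 \<eta>(1) e\<eta> unfolding q_def
      by (intro card_low_degree_le[OF Q that(1,2) L K, where e = e]) (auto simp: N_def q_def)
  qed
  have main: "N \<le> card (verts H) \<longrightarrow> (1 - e) * L \<le> avg (image_mult Q H) q (verts H) \<longrightarrow>
     induced H (verts H - low_degree Q ((1 - \<kappa>) * L) H) \<in> \<HH>" if "rgraph r H" "free \<F> H" for H
    using that Q inc inv
  proof (induction rule: symmetrization_induct)
    case (symmetrized H)
    then have "H \<in> \<HH>" using st by (simp add: symmetrized_stable_def)
    then have "induced H (verts H) \<in> \<HH>" using induced_verts symmetrized(1) by metis
    then show ?case using hereditary_induced[OF her _ symmetrized(1)] by blast
  next
    case (step H H' u)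
    show ?case
    proof (intro impI)
      assume big: "N \<le> card (verts H)" and many: "(1 - e) * L \<le> avg (image_mult Q H) q (verts H)"
      define V where "V = verts H"
      define n where "n = card V"
      have finV: "finite V" using step(1) by (simp add: rgraph_def V_def)
      have nN: "N \<le> n" using big by (simp add: n_def V_def)
      have "real (n choose q) * avg (image_mult Q H) q V \<le> real (n choose q) * avg (image_mult Q H') q V"
        using step(5,7) inj_count_eq_avg[OF Q step(1)] inj_count_eq_avg[OF Q step(3)]
        by (simp add: q_def n_def V_def flip: of_nat_le_iff)
      moreover have "0 < real (n choose q)" using nN by (simp add: N_def)
      ultimately have many': "(1 - e) * L \<le> avg (image_mult Q H') q V" using many by (simp add: V_def)
      define A where "A = low_degree Q ((1 - \<kappa>) * L) H"
      define A' where "A' = low_degree Q ((1 - \<kappa>) * L) H'"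
      have H'in: "induced H' (V - A') \<in> \<HH>" using step(5,8) many' big by (simp add: A'_def V_def)
      \<comment> \<open>\<open>H\<close> and \<open>H'\<close> induce the same graph on
        \<open>W\<close>, and heredity puts it into \<open>\<HH>\<close>. It remains to restore
        \<open>T - W\<close>, whose vertices lie in \<open>A'\<close> or equal
        \<open>u\<close>.\<close>
      define W where "W = V - (A \<union> A' \<union> {u})"
      define T where "T = V - A"
      have "induced H' W \<in> \<HH>"
        using step(5) by (intro hereditary_induced[OF her H'in step(3)]) (auto simp: W_def V_def)
      then have HW: "induced H W \<in> \<HH>" using step(6)[of W] by (simp add: W_def)
      have cA: "real (card A) \<le> \<zeta> * real n" "real (card A') \<le> \<zeta> * real n"
        using small[OF step(1,2) big many] small[OF step(3,4)] step(5) big many'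
        by (simp_all add: A_def A'_def n_def V_def)
      have diff: "real (card (V - U)) \<le> 3 * \<zeta> * real n" if "W \<subseteq> U" for U
      proof -
        have "V - U \<subseteq> A \<union> A' \<union> {u}" using that by (auto simp: W_def)
        moreover have "finite A" "finite A'" using step(5) finV by (auto simp: A_def A'_def low_degree_def V_def)
        ultimately have "card (V - U) \<le> card (A \<union> A' \<union> {u})" by (intro card_mono) auto
        also have "\<dots> \<le> card A + card A' + 1"
          using card_Un_le[of "A \<union> A'" "{u}"] card_Un_le[of A A'] by simp
        finally have "real (card (V - U)) \<le> 2 * (\<zeta> * real n) + 1" using cA by linarith
        moreover have "1 / \<zeta> \<le> real n" using nN unfolding N_def by linarith
        then have "1 \<le> \<zeta> * real n" using \<zeta>0 by (simp add: field_simps)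
        ultimately show ?thesis by linarith
      qed
      have cU: "real n / 2 \<le> real (card U)" if "W \<subseteq> U" "U \<subseteq> V" for U
      proof -
        have "card U + card (V - U) = n"
          using that(2) finV by (metis card_Diff_subset card_mono finite_subset le_add_diff_inverse n_def)
        moreover have "3 * \<zeta> * real n \<le> 1 / 4 * real n" using \<zeta>1 by (intro mult_right_mono) auto
        ultimately show ?thesis using diff[OF that(1)] by linarith
      qed
      have "induced H T \<in> \<HH>"
      proof (rule extend_induced[OF step(1,2) _ _ HW, where Q = Q and \<epsilon> = \<epsilon> and ?N0.0 = N0])
        show "T \<subseteq> verts H" "W \<subseteq> T" by (auto simp: T_def V_def W_def)
        show "N0 \<le> card W" using cU[of W] nN unfolding N_def by (auto simp: W_def)
        show "G \<in> \<HH>" if "rgraph r G" "free \<F> G" "N0 \<le> card (verts G)" "large_min_degree r Q \<F> \<epsilon> G"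
            "\<exists>v\<in>verts G. remove_vertex G v \<in> \<HH>" for G
          using that by (rule ext)
        fix U assume U: "W \<subseteq> U" "U \<subseteq> T" "U \<noteq> {}"
        have UV: "U \<subseteq> V" using U by (auto simp: T_def)
        have cUn: "real n / 2 \<le> real (card U)" by (rule cU) (use U UV in auto)
        have Uq: "q < card U" "K \<le> card U" using cUn nN unfolding N_def by linarith+
        have finU: "finite U" using UV finV finite_subset by blast
        have "deg_density_ge Q ((1 - \<epsilon>) * inj_density r Q \<F> (card U)) H U"
          unfolding deg_density_ge_def disj_imp
        proof (intro impI ballI)
          fix v assume v: "v \<in> U" and "card (verts Q) \<noteq> 0"
          then have q1: "1 \<le> q" by (simp add: q_def)
          have "v \<in> V" "v \<notin> A" using v U by (auto simp: T_def)
          then have degV: "(1 - \<kappa>) * L \<le> deg_density Q H v V" using q1 by (auto simp: A_def low_degree_def V_def q_def)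
          have cUv: "card (U - {v}) = card U - 1" using v finU by simp
          \<comment> \<open>\<open>v\<close> has large degree in all of \<open>V\<close>; at most
            \<open>3 * \<zeta> * n\<close> vertices are missing from \<open>U\<close>, and each
            costs at most \<open>c / (n / 4)\<close>.\<close>
          have "\<bar>deg_density Q H v U - deg_density Q H v V\<bar> \<le>
              real (card ((V - {v}) - (U - {v}))) * (M * real (q - 1) / real (card (U - {v}) + 1 - (q - 1)))"
            unfolding q_def[symmetric] using UV finV Uq cUv
            by (intro avg_subset_bound image_mult_nonneg multM) auto
          also have "(V - {v}) - (U - {v}) = V - U" using v by auto
          also have "real (card (V - U)) * (M * real (q - 1) / real (card (U - {v}) + 1 - (q - 1)))
              \<le> (3 * \<zeta> * real n) * (c / (real n / 4))"
          proof (rule mult_mono)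
            show "real (card (V - U)) \<le> 3 * \<zeta> * real n" by (rule diff[OF U(1)])
            have "real n / 4 \<le> real (card (U - {v}) + 1 - (q - 1))"
              using cUn nN cUv Uq unfolding N_def by linarith
            moreover have "0 < real n" using nN by (simp add: N_def)
            ultimately show "M * real (q - 1) / real (card (U - {v}) + 1 - (q - 1)) \<le> c / (real n / 4)"
              unfolding c_def[symmetric] using c by (intro frac_le) auto
          qed (use \<zeta>0 c in \<open>auto simp: M_def\<close>)
          also have "\<dots> = 12 * \<zeta> * c" using nN by (simp add: N_def)
          finally have "(1 - \<kappa>) * L - \<epsilon> * L / 4 \<le> deg_density Q H v U" using degV \<zeta>3 by linarith
          \<comment> \<open>Three relative losses of at most \<open>\<epsilon> / 4\<close> each: the
            low-degree threshold, the excess of the extremal density over \<open>L\<close>, and the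
            vertices missing from \<open>U\<close>.\<close>
          moreover have "(1 - \<epsilon>) * inj_density r Q \<F> (card U) \<le> (1 - \<kappa>) * L - \<epsilon> * L / 4"
          proof -
            have "(1 - \<epsilon>) * inj_density r Q \<F> (card U) \<le> (1 - \<epsilon>) * ((1 + \<eta>) * L)"
              using K[OF Uq(2)] \<epsilon>(2) by (intro mult_left_mono) auto
            also have "\<dots> = (1 - \<epsilon> + \<eta> - \<epsilon> * \<eta>) * L" by (simp add: algebra_simps)
            also have "\<dots> \<le> (1 - \<kappa> - \<epsilon> / 4) * L"
              using \<eta>(1,2) \<epsilon>(1) L mult_pos_pos[OF \<epsilon>(1) \<eta>(1)] unfolding \<kappa>_def
              by (intro mult_right_mono) linarith+
            finally show ?thesis by (simp add: algebra_simps)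
          qed
          ultimately show "(1 - \<epsilon>) * inj_density r Q \<F> (card U) \<le> deg_density Q H v U" by linarith
        qed
        then show "large_min_degree r Q \<F> \<epsilon> (induced H U)"
          using large_min_degree_iff_deg_density[OF Q step(1)] UV U(3) Uq by (simp add: V_def q_def)
      qed
      then show "induced H (verts H - low_degree Q ((1 - \<kappa>) * L) H) \<in> \<HH>" by (simp add: T_def A_def V_def)
    qed
  qed
  show ?thesis
    using main e \<kappa> unfolding q_def by blast
qed

section \<open>Extending from a random sample\<close>

text \<open>Union bound: given \<open>v \<in> S\<close>, the rest of \<open>S\<close> is a random
  \<open>(k - 1)\<close>-subset of the other vertices, so \<open>avg_concentration\<close> applies.
  Only vertices of \<open>S\<close> enter, so the factor is \<open>k\<close> and not the order of
  \<open>H\<close>.\<close>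

lemma avg_not_deg_density_ge_le:
  assumes Q: "rgraph r Q" and H: "rgraph r H" and good: "deg_density_ge Q \<theta> H (verts H)"
    and k: "card (verts Q) < k" "k \<le> card (verts H)"
    and c: "real (card (verts Q) ^ card (verts Q)) * real (card (verts Q) - 1) \<le> c" "0 < t" "t \<le> c"
  shows "avg (\<lambda>S. of_bool (\<not> deg_density_ge Q (\<theta> - t) H S)) k (verts H)
     \<le> real k * exp (- (t\<^sup>2 / (4 * c\<^sup>2)) * real (k - card (verts Q)))"
proof (cases "card (verts Q) = 0")
  case True
  then show ?thesis by (simp add: deg_density_ge_def avg_def)
next
  case False
  define q where "q = card (verts Q)"
  define V where "V = verts H"
  define n where "n = card V"
  define p where "p = exp (- (t\<^sup>2 / (4 * c\<^sup>2)) * real (k - q))"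
  have q1: "1 \<le> q" using False by (simp add: q_def)
  have finV: "finite V" using H by (simp add: rgraph_def V_def)
  have kn: "q < k" "k \<le> n" using k by (auto simp: q_def n_def V_def)
  define b where "b v S = (of_bool (deg_density Q H v S < \<theta> - t) :: real)" for v S
  have p: "(\<Sum>w\<in>ksub (V - {v}) (k - 1). b v (insert v w)) \<le> real (n - 1 choose (k - 1)) * p" if v: "v \<in> V" for v
  proof -
    let ?f = "\<lambda>B. image_mult Q H (insert v B)"
    have cW: "card (V - {v}) = n - 1" using v finV by (simp add: n_def)
    have "avg (\<lambda>w. of_bool (avg ?f (q - 1) w < avg ?f (q - 1) (V - {v}) - t)) (k - 1) (V - {v})
        \<le> exp (- (t\<^sup>2 / (4 * c\<^sup>2)) * real (k - 1 - (q - 1)))"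
    proof (rule avg_concentration)
      show "?f A \<le> real (q ^ q)" for A using image_mult_le[of Q] Q by (simp add: q_def rgraph_def)
    qed (use finV kn cW q1 c image_mult_nonneg in \<open>auto simp: q_def\<close>)
    moreover have "k - 1 - (q - 1) = k - q" using q1 by simp
    moreover have "avg (\<lambda>w. b v (insert v w)) (k - 1) (V - {v}) \<le>
        avg (\<lambda>w. of_bool (avg ?f (q - 1) w < avg ?f (q - 1) (V - {v}) - t)) (k - 1) (V - {v})"
    proof (rule avg_mono)
      fix w assume "w \<subseteq> V - {v}"
      then have "insert v w - {v} = w" by auto
      moreover have "\<theta> \<le> avg ?f (q - 1) (V - {v})"
        using good v False by (auto simp: deg_density_ge_def V_def q_def)
      ultimately show "b v (insert v w) \<le> of_bool (avg ?f (q - 1) w < avg ?f (q - 1) (V - {v}) - t)"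
        by (auto simp: b_def q_def)
    qed
    ultimately have "avg (\<lambda>w. b v (insert v w)) (k - 1) (V - {v}) \<le> p" by (simp add: p_def)
    moreover have "0 < real (n - 1 choose (k - 1))" using kn by simp
    ultimately show ?thesis unfolding avg_def cW by (simp only: pos_divide_le_eq mult.commute)
  qed
  have "avg (\<lambda>S. of_bool (\<not> deg_density_ge Q (\<theta> - t) H S)) k V \<le> avg (\<lambda>S. \<Sum>v\<in>S. b v S) k V"
  proof (rule avg_mono)
    fix S assume "S \<subseteq> V"
    then have finS: "finite S" using finV finite_subset by blast
    have nn: "0 \<le> (\<Sum>v\<in>S. b v S)" by (intro sum_nonneg) (auto simp: b_def)
    show "of_bool (\<not> deg_density_ge Q (\<theta> - t) H S) \<le> (\<Sum>v\<in>S. b v S)"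
    proof (cases "deg_density_ge Q (\<theta> - t) H S")
      case False
      then obtain v where v: "v \<in> S" "b v S = 1" by (auto simp: deg_density_ge_def b_def not_le)
      then have "b v S \<le> (\<Sum>v\<in>S. b v S)" using finS by (intro member_le_sum) (auto simp: b_def)
      then show ?thesis using v by simp
    qed (use nn in simp)
  qed
  also have "\<dots> = (\<Sum>S\<in>ksub V k. \<Sum>v\<in>{v\<in>V. v \<in> S}. b v S) / real (n choose k)"
    unfolding avg_def n_def by (intro arg_cong2[where f = divide] sum.cong refl) (auto simp: ksub_def)
  also have "(\<Sum>S\<in>ksub V k. \<Sum>v\<in>{v\<in>V. v \<in> S}. b v S) = (\<Sum>v\<in>V. \<Sum>S\<in>{S\<in>ksub V k. v \<in> S}. b v S)"
    by (rule sum.swap_restrict) (use finV in auto)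
  also have "\<dots> = (\<Sum>v\<in>V. \<Sum>w\<in>ksub (V - {v}) (k - 1). b v (insert v w))"
    using kn by (intro sum.cong refl sum_ksub_containing finV) auto
  also have "\<dots> \<le> (\<Sum>v\<in>V. real (n - 1 choose (k - 1)) * p)"
    by (intro sum_mono p)
  also have "\<dots> = real k * real (n choose k) * p"
    using times_binomial_real[of k n] kn by (simp add: n_def)
  finally have "avg (\<lambda>S. of_bool (\<not> deg_density_ge Q (\<theta> - t) H S)) k V \<le> real k * real (n choose k) * p / real (n choose k)"
    by (simp add: divide_right_mono)
  then show ?thesis using kn by (simp add: p_def q_def V_def)
qed

text \<open>Comparison with the derivative of the geometric series of ratio
  \<open>exp (- \<alpha>)\<close>; the shift by \<open>q\<close> costs a constant factor.\<close>

lemma summable_times_exp: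
  fixes \<alpha> :: real
  assumes "0 < \<alpha>"
  shows "summable (\<lambda>k. real k * exp (- \<alpha> * real (k - q)))"
proof -
  define x where "x = exp (- \<alpha>)"
  have x: "0 < x" "x < 1" using assms by (auto simp: x_def)
  have "summable (\<lambda>n. diffs (\<lambda>_. 1) n * x ^ n)"
    by (rule termdiff_converges[where K = 1]) (use x in \<open>auto simp: summable_geometric\<close>)
  then have "summable (\<lambda>n. real (Suc n) * x ^ n)" by (simp add: diffs_def)
  then have sm: "summable (\<lambda>n. exp (\<alpha> * real q) * (real (Suc n) * x ^ n))" by (rule summable_mult)
  show ?thesis
  proof (rule summable_comparison_test'[OF sm])
    fix k :: nat
    have "exp (- \<alpha> * real (k - q)) \<le> exp (\<alpha> * real q + real k * (- \<alpha>))"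
    proof -
      have "real k - real q \<le> real (k - q)" by simp
      then have "\<alpha> * (real k - real q) \<le> \<alpha> * real (k - q)" using assms by (intro mult_left_mono) auto
      then show ?thesis by (simp add: algebra_simps)
    qed
    also have "\<dots> = exp (\<alpha> * real q) * x ^ k" unfolding exp_add x_def exp_of_nat_mult ..
    finally have "real k * exp (- \<alpha> * real (k - q)) \<le> real (Suc k) * (exp (\<alpha> * real q) * x ^ k)"
      by (intro mult_mono) auto
    then show "norm (real k * exp (- \<alpha> * real (k - q))) \<le> exp (\<alpha> * real q) * (real (Suc k) * x ^ k)"
      by (simp add: ac_simps)
  qed
qed

text \<open>\<open>r \<ge> 1\<close> excludes the empty edge, so the empty map always counts. This
  settles the case in which \<open>deg_density_ge\<close> is trivially true.\<close>

lemma inj_count_no_verts: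
  assumes "rgraph r Q" "r \<ge> 1" "card (verts Q) = 0"
  shows "inj_count Q H = 1"
proof -
  have "verts Q = {}" using assms by (auto simp: rgraph_def)
  moreover from this have "edges Q = {}" using assms by (fastforce simp: rgraph_def)
  ultimately have "inj_homs Q H = {\<lambda>_. undefined}" by (auto simp: inj_homs_def hom_def)
  then show ?thesis by (simp add: inj_count_def)
qed

lemma inj_density_no_verts:
  assumes "rgraph r Q" "r \<ge> 1" "card (verts Q) = 0"
  shows "inj_density r Q \<F> n \<le> 1"
  by (cases rule: inj_max_cases[OF assms(1), of n \<F>])
    (use inj_count_no_verts[OF assms] assms(3) in \<open>auto simp: inj_density_def\<close>)

text \<open>Contraposition of extendability: if \<open>U\<close> has large degrees and spans no
  member of \<open>\<HH>\<close>, then neither does any of its \<open>k\<close>-subsets. Averaging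
  over \<open>U\<close> gives the recursion that stands for one step of the random chain.\<close>

lemma avg_not_in_family_step:
  assumes H: "rgraph r H" "free \<F> H" and Q: "rgraph r Q"
    and k: "k < card (verts H)" "card (verts Q) \<le> k" "N0 \<le> k"
    and ext: "\<And>H. rgraph r H \<Longrightarrow> free \<F> H \<Longrightarrow> N0 \<le> card (verts H) \<Longrightarrow> large_min_degree r Q \<F> \<epsilon> H \<Longrightarrow>
      \<exists>v\<in>verts H. remove_vertex H v \<in> \<HH> \<Longrightarrow> H \<in> \<HH>"
    and \<theta>: "(1 - \<epsilon>) * inj_density r Q \<F> (Suc k) \<le> \<theta>"
  shows "avg (\<lambda>S. of_bool (induced H S \<notin> \<HH>)) (Suc k) (verts H) \<le>
    avg (\<lambda>S. of_bool (induced H S \<notin> \<HH>)) k (verts H) + avg (\<lambda>S. of_bool (\<not> deg_density_ge Q \<theta> H S)) (Suc k) (verts H)"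
proof -
  let ?f = "\<lambda>S. of_bool (induced H S \<notin> \<HH>) :: real"
  let ?V = "verts H"
  have finV: "finite ?V" using H by (simp add: rgraph_def)
  have "avg ?f (Suc k) ?V \<le> avg (\<lambda>U. avg ?f k U + of_bool (\<not> deg_density_ge Q \<theta> H U)) (Suc k) ?V"
  proof (rule avg_mono)
    fix U assume U: "U \<subseteq> ?V" "card U = Suc k"
    have finU: "finite U" using U(1) finV finite_subset by blast
    have nn: "0 \<le> avg ?f k U" by (intro avg_nonneg) simp
    show "?f U \<le> avg ?f k U + of_bool (\<not> deg_density_ge Q \<theta> H U)"
    proof (cases "induced H U \<notin> \<HH> \<and> deg_density_ge Q \<theta> H U")
      case True
      have "large_min_degree r Q \<F> \<epsilon> (induced H U)"
        using large_min_degree_iff_deg_density[OF Q H(1) U(1)] True deg_density_ge_mono \<theta> U(2) k by fastforce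
      then have no: "remove_vertex (induced H U) v \<notin> \<HH>" if "v \<in> U" for v
        using that True ext[of "induced H U"] rgraph_induced[OF H(1) U(1)]
          free_mono[OF subgraph_induced[OF U(1)] H(2)] U(2) k by auto
      have "?f S = 1" if S: "S \<subseteq> U" "card S = k" for S
      proof -
        have "card (U - S) = 1" using S U(2) finU by (simp add: card_Diff_subset finite_subset)
        then obtain v where v: "U - S = {v}" by (auto simp: card_1_singleton_iff)
        then have "S = U - {v}" "v \<in> U" using S by auto
        then show ?thesis using no[of v] by (simp add: remove_vertex_induced)
      qed
      then have "avg ?f k U = avg (\<lambda>_. 1) k U" by (intro avg_cong)
      also have "\<dots> = 1" using U finU by (simp add: avg_const)
      finally show ?thesis by simp
    qed (use nn in auto)
  qed
  also have "\<dots> = avg (avg ?f k) (Suc k) ?V + avg (\<lambda>S. of_bool (\<not> deg_density_ge Q \<theta> H S)) (Suc k) ?V"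
    by (rule avg_add)
  also have "avg (avg ?f k) (Suc k) ?V = avg ?f k ?V"
    using k by (intro avg_tower finV) auto
  finally show ?thesis .
qed

theorem theorem4p9:
  fixes r :: nat and Q :: hypergraph and \<F> \<F>' \<HH> :: "hypergraph set"
  assumes "r \<ge> 2"
    and "rgraph r Q"
    and "\<forall>F\<in>\<F>. rgraph r F"
    and "\<forall>F\<in>\<F>'. rgraph r F"
    and "le_hom \<F>' \<F>"
    and "pi_inj r Q \<F> > 0"
    and "\<forall>H\<in>\<HH>. rgraph r H \<and> free (\<F>' \<union> \<F>) H"
    and "hereditary r \<HH>"
    and "symmetrization_increasing r Q"
    and "blowup_invariant r \<F>'"
    and "symmetrized_stable r \<F>' \<HH>"
    and "vertex_extendable r Q \<F>' \<HH>"
    and "vertex_extendable r Q \<F> \<HH>"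
  shows "degree_stable r Q \<F> \<HH>"
proof -
  note Q = assms(2)
  define q where "q = card (verts Q)"
  obtain L where L: "L > 0" "inj_density r Q \<F> \<longlonglongrightarrow> L" "\<And>n. q \<le> n \<Longrightarrow> L \<le> inj_density r Q \<F> n"
    using inj_density_limit[OF Q assms(6)] by (metis q_def)
  have dens: "\<exists>K. \<forall>k\<ge>K. inj_density r Q \<F> k \<le> (1 + \<eta>) * L" if "0 < \<eta>" for \<eta>
  proof -
    have "L < (1 + \<eta>) * L" using that L(1) by simp
    from order_tendstoD(2)[OF L(2) this] show ?thesis
      unfolding eventually_sequentially by (meson less_imp_le)
  qed
  have "inj_max r n Q \<F>' \<le> inj_max r n Q \<F>" for n
    using assms(7) by (intro inj_max_le_if_symmetrized_stable[OF Q _ assms(9-11)]) (auto simp: free_def)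
  then have "inj_density r Q \<F>' n \<le> inj_density r Q \<F> n" for n
    unfolding inj_density_def by (intro divide_right_mono) auto
  then have dens': "\<exists>K. \<forall>k\<ge>K. inj_density r Q \<F>' k \<le> (1 + \<eta>) * L" if "0 < \<eta>" for \<eta>
    using dens[OF that] by (meson order_trans)
  obtain e \<kappa> N1 where e: "0 < e" and \<kappa>: "0 < \<kappa>" and ex: "\<And>H. rgraph r H \<Longrightarrow> free \<F>' H \<Longrightarrow> N1 \<le> card (verts H) \<Longrightarrow>
      (1 - e) * L \<le> avg (image_mult Q H) q (verts H) \<Longrightarrow> induced H (verts H - low_degree Q ((1 - \<kappa>) * L) H) \<in> \<HH>"
    using almost_extremal_in_family[OF Q assms(8-12) L(1) dens'] unfolding q_def by blast
  obtain \<epsilon> N2 where \<epsilon>: "0 < \<epsilon>" "\<epsilon> \<le> 1" and ext: "\<And>H. rgraph r H \<Longrightarrow> free \<F> H \<Longrightarrow> N2 \<le> card (verts H) \<Longrightarrow>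
      large_min_degree r Q \<F> \<epsilon> H \<Longrightarrow> \<exists>v\<in>verts H. remove_vertex H v \<in> \<HH> \<Longrightarrow> H \<in> \<HH>"
    using vertex_extendableE[OF assms(13)] by blast
  \<comment> \<open>The slack gives
    \<open>(1 - \<epsilon>) * (1 + \<tau>) \<le> 1 - 2 * \<tau>\<close> for the extension, and keeps
    \<open>1 - 2 * \<tau>\<close> above \<open>1 - e\<close> and \<open>1 - \<kappa>\<close> for the
    sample.\<close>
  define \<tau> where "\<tau> = min (min e \<kappa>) \<epsilon> / 4"
  have \<tau>: "0 < \<tau>" "2 * \<tau> \<le> e" "2 * \<tau> \<le> \<kappa>" "4 * \<tau> \<le> \<epsilon>"
    using e \<kappa> \<epsilon> by (auto simp: \<tau>_def min_def)
  \<comment> \<open>\<open>H\<close> has degree densities at least \<open>(1 - \<tau>) * L\<close>;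
    a random subset may lose a further \<open>t\<close>.\<close>
  define \<theta> where "\<theta> = (1 - 2 * \<tau>) * L"
  define t where "t = \<tau> * L"
  have t: "0 < t" using \<tau> L by (simp add: t_def)
  \<comment> \<open>The summand \<open>t\<close> ensures \<open>t \<le> c\<close> and
    \<open>c > 0\<close>, also when \<open>q \<le> 1\<close>.\<close>
  define c where "c = real (q ^ q) * real (q - 1) + t"
  have c: "real (q ^ q) * real (q - 1) \<le> c" "t \<le> c" using t by (auto simp: c_def)
  define \<alpha> where "\<alpha> = t\<^sup>2 / (4 * c\<^sup>2)"
  have \<alpha>: "0 < \<alpha>" using t c by (simp add: \<alpha>_def)
  define E where "E k = real k * exp (- \<alpha> * real (k - q))" for k
  obtain K where K: "\<And>k. K \<le> k \<Longrightarrow> inj_density r Q \<F> k \<le> (1 + \<tau>) * L" using dens[OF \<tau>(1)] by blast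
  have "summable E" unfolding E_def by (rule summable_times_exp[OF \<alpha>])
  then obtain N3 where N3: "\<And>m n. N3 \<le> m \<Longrightarrow> norm (\<Sum>k=m..n. E k) < 1 / 4"
    by (rule summable_partial_sum_bound[of E "1 / 4"]) auto
  \<comment> \<open>\<open>m\<close> is chosen before \<open>H\<close>: it exceeds all thresholds
    and starts a tail of \<open>E\<close> with sums below \<open>1 / 4\<close>.\<close>
  define m where "m = K + N1 + N2 + N3 + q + 1"
  obtain n0 where n0: "\<And>H. rgraph r H \<Longrightarrow> free \<F> H \<Longrightarrow> n0 \<le> card (verts H) \<Longrightarrow>
      avg (\<lambda>S. of_bool (\<not> free \<F>' (induced H S))) m (verts H) \<le> 1 / 4"
    using sample_free[OF assms(5,3), of m "1 / 4"] by (auto simp: m_def)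
  have "H \<in> \<HH>" if H: "rgraph r H" "free \<F> H" "n0 + m \<le> card (verts H)" "large_min_degree r Q \<F> \<tau> H" for H
  proof -
    define V where "V = verts H"
    define n where "n = card V"
    have finV: "finite V" using H by (simp add: rgraph_def V_def)
    have mn: "m \<le> n" using H by (simp add: n_def V_def)
    have V_ne: "V \<noteq> {}" using mn by (auto simp: n_def m_def)
    let ?f = "\<lambda>S. of_bool (induced H S \<notin> \<HH>) :: real"
    have goodV: "deg_density_ge Q ((1 - \<tau>) * L) H V"
    proof -
      have "deg_density_ge Q ((1 - \<tau>) * inj_density r Q \<F> n) H V"
        using large_min_degree_iff_deg_density[OF Q H(1) order_refl] induced_verts[OF H(1)] H(4) mn V_ne
        by (auto simp: V_def n_def m_def q_def)
      moreover have "(1 - \<tau>) * L \<le> (1 - \<tau>) * inj_density r Q \<F> n"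
        using L(3)[of n] mn \<tau> \<epsilon> by (intro mult_left_mono) (auto simp: m_def)
      ultimately show ?thesis by (rule deg_density_ge_mono)
    qed
    have bad: "avg (\<lambda>S. of_bool (\<not> deg_density_ge Q \<theta> H S)) k V \<le> E k" if "q < k" "k \<le> n" for k
    proof -
      have "(1 - \<tau>) * L - t = \<theta>" by (simp add: \<theta>_def t_def algebra_simps)
      then show ?thesis
        using avg_not_deg_density_ge_le[OF Q H(1) goodV[unfolded V_def], of k c t] that c t
        by (simp add: E_def \<alpha>_def q_def V_def n_def)
    qed
    have base: "avg ?f m V \<le> 1 / 4 + E m"
    proof -
      have "avg ?f m V \<le> avg (\<lambda>S. of_bool (\<not> free \<F>' (induced H S)) + of_bool (\<not> deg_density_ge Q \<theta> H S)) m V"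
      proof (rule avg_mono)
        fix S assume S: "S \<subseteq> V" "card S = m"
        have finS: "finite S" using S finV finite_subset by blast
        have "induced H S \<in> \<HH>" if fr: "free \<F>' (induced H S)" and good: "deg_density_ge Q \<theta> H S"
        proof -
          have rS: "rgraph r (induced H S)" using rgraph_induced[OF H(1)] S by (simp add: V_def)
          have SV: "S \<subseteq> verts H" using S by (simp add: V_def)
          have "avg (image_mult Q (induced H S)) q S = avg (image_mult Q H) q S"
            using image_mult_induced[OF Q SV] by (intro avg_cong) auto
          moreover have "(1 - e) * L \<le> avg (image_mult Q H) q S"
          proof (cases "q = 0")
            case False
            have "(1 - e) * L \<le> \<theta>" unfolding \<theta>_def using \<tau> L by (intro mult_right_mono) auto
            also have "\<theta> \<le> avg (image_mult Q H) q S"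
              using deg_density_ge_imp_avg[OF finS _ _ good] False S(2) by (simp add: q_def m_def)
            finally show ?thesis .
          next
            \<comment> \<open>Here the degree condition says nothing, but every graph admits exactly
              one map, so the average is \<open>1\<close> and \<open>L \<le> 1\<close>.\<close>
            case True
            have "avg (image_mult Q H) q S = 1"
              using inj_count_induced[OF Q H(1) SV] inj_count_no_verts[OF Q, of "induced H S"] True assms(1)
              by (simp add: q_def)
            moreover have "L \<le> 1"
              using L(3)[of 0] inj_density_no_verts[OF Q, of \<F> 0] True assms(1) by (simp add: q_def)
            moreover have "(1 - e) * L \<le> L" using e L by simp
            ultimately show ?thesis by linarith
          qed
          ultimately have "induced (induced H S) (S - low_degree Q ((1 - \<kappa>) * L) (induced H S)) \<in> \<HH>"
            using ex[OF rS fr] S(2) by (simp add: m_def)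
          \<comment> \<open>All degree densities within \<open>S\<close> are at least \<theta>, so
            nothing is deleted and \<open>S\<close> itself spans a member of
            \<open>\<HH>\<close>.\<close>
          moreover have "low_degree Q ((1 - \<kappa>) * L) (induced H S) = {}"
          proof -
            have "(1 - \<kappa>) * L \<le> deg_density Q (induced H S) v S" if v: "v \<in> S" "1 \<le> q" for v
            proof -
              have "deg_density Q (induced H S) v S = deg_density Q H v S"
                by (intro avg_cong image_mult_induced[OF Q SV]) (use v in auto)
              moreover have "\<theta> \<le> deg_density Q H v S" using good v by (auto simp: deg_density_ge_def q_def)
              moreover have "(1 - \<kappa>) * L \<le> \<theta>" unfolding \<theta>_def using \<tau> L by (intro mult_right_mono) auto
              ultimately show ?thesis by linarith
            qed
            then show ?thesis by (force simp: low_degree_def q_def)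
          qed
          ultimately show ?thesis by (simp add: induced_induced)
        qed
        then show "?f S \<le> of_bool (\<not> free \<F>' (induced H S)) + of_bool (\<not> deg_density_ge Q \<theta> H S)" by auto
      qed
      also have "\<dots> = avg (\<lambda>S. of_bool (\<not> free \<F>' (induced H S))) m V + avg (\<lambda>S. of_bool (\<not> deg_density_ge Q \<theta> H S)) m V"
        by (rule avg_add)
      also have "\<dots> \<le> 1 / 4 + E m"
        using n0[OF H(1,2)] H(3) bad[of m] mn by (intro add_mono) (auto simp: V_def m_def)
      finally show ?thesis .
    qed
    have "avg ?f k V \<le> 1 / 4 + (\<Sum>j=m..k. E j)" if "m \<le> k" "k \<le> n" for k
      using that
    proof (induction k rule: dec_induct)
      case base
      then show ?case using \<open>avg ?f m V \<le> 1 / 4 + E m\<close> by simp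
    next
      case (step k)
      have "(1 - \<epsilon>) * inj_density r Q \<F> (Suc k) \<le> (1 - \<epsilon>) * ((1 + \<tau>) * L)"
        using K[of "Suc k"] step \<epsilon> by (intro mult_left_mono) (auto simp: m_def)
      also have "\<dots> = (1 - \<epsilon> + \<tau> - \<epsilon> * \<tau>) * L" by (simp add: algebra_simps)
      also have "\<dots> \<le> \<theta>" unfolding \<theta>_def
        using \<tau> L \<epsilon> mult_pos_pos[OF \<epsilon>(1) \<tau>(1)] by (intro mult_right_mono) linarith+
      finally have "avg ?f (Suc k) V \<le> avg ?f k V + avg (\<lambda>S. of_bool (\<not> deg_density_ge Q \<theta> H S)) (Suc k) V"
        unfolding V_def using step
        by (intro avg_not_in_family_step[OF H(1,2) Q _ _ _ ext]) (auto simp: n_def V_def m_def q_def)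
      also have "\<dots> \<le> 1 / 4 + (\<Sum>j=m..k. E j) + E (Suc k)"
        using step bad[of "Suc k"] by (intro add_mono) (auto simp: m_def)
      finally show ?case using step by simp
    qed
    \<comment> \<open>The bound is below \<open>1 / 2\<close>. At \<open>k = n\<close> the only
      subset is \<open>V\<close>, so the average is \<open>0\<close> or \<open>1\<close> and must be
      \<open>0\<close>.\<close>
    from this[OF mn order_refl] have "avg ?f n V < 1" using N3[of m n] by (simp add: m_def)
    then have "induced H V \<in> \<HH>" using avg_card_self[OF finV, of ?f] by (auto simp: n_def split: if_splits)
    then show ?thesis using induced_verts[OF H(1)] by (simp add: V_def)
  qed
  then show ?thesis unfolding degree_stable_def using \<tau>(1) by blast
qed

end
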